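(* Let $H$ be a non-elementary hyperbolic group, let $K$ be a finitely generated group, and let $S$ be a split finite generating set for $H\times K$. Let $S_H$ and $S_K$ be the generating sets of $H$ and $K$ obtained by projecting $S$ to the two factors, and suppose that the growth function of $(H,S_H)$ dominates the growth function of $(K,S_K)$, i.e. $(K,S_K)$ either has subexponential growth or has exponential growth rate strictly smaller than that of $(H,S_H)$. Then $(H\times K,S)$ is statistically hyperbolic, i.e. $E(H\times K,S)$ exists and equals $2$.
   Context: For a group $G$ with finite generating set $S$, let $d$ be the word metric on $G$ with respect to $S$, and let $S_n$ be the sphere of radius $n$ about the identity. The sprawl is $$E(G,S):=\lim_{n\to\infty}\frac{1}{|S_n|^2}\sum_{x,y\in S_n}\frac1n\, d(x,y),$$ provided the limit exists; $(G,S)$ is called statistically hyperbolic if $E(G,S)=2$. The growth function of $(G,S)$ is $\beta(n)=\#\{x\in G: d(e,x)\le n\}$, and its exponential growth rate is $\lim_{n\to\infty}\beta(n)^{1/n}$ (subexponential growth means this equals $1$). A hyperbolic group is non-elementary if it is infinite and has no finite-index cyclic subgroup. A generating set of a direct product $H\times K$ is split if every generator projects to the identity in one of the two factors. *)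

theory Defs
  imports Complex_Main "HOL-Algebra.Generated_Groups"
begin

definition finite_generating_set :: "('a, 'm) monoid_scheme \<Rightarrow> 'a set \<Rightarrow> bool" where
  "finite_generating_set G S \<longleftrightarrow> finite S \<and> S \<subseteq> carrier G \<and> generate G S = carrier G"

definition finitely_generated_group :: "('a, 'm) monoid_scheme \<Rightarrow> bool" where
  "finitely_generated_group G \<longleftrightarrow> group G \<and> (\<exists>S. finite_generating_set G S)"

definition word_value :: "('a, 'm) monoid_scheme \<Rightarrow> 'a list \<Rightarrow> 'a" where
  "word_value G ws = foldr (\<lambda>a x. a \<otimes>\<^bsub>G\<^esub> x) ws \<one>\<^bsub>G\<^esub>"

(* Letters are elements of S and their inverses; S itself is not assumed symmetric and may
   contain the identity.  Only meaningful for x in the subgroup generated by S. *)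
definition word_length :: "('a, 'm) monoid_scheme \<Rightarrow> 'a set \<Rightarrow> 'a \<Rightarrow> nat" where
  "word_length G S x =
     (LEAST n. \<exists>ws. length ws = n \<and> set ws \<subseteq> S \<union> m_inv G ` S \<and> word_value G ws = x)"

definition word_dist :: "('a, 'm) monoid_scheme \<Rightarrow> 'a set \<Rightarrow> 'a \<Rightarrow> 'a \<Rightarrow> nat" where
  "word_dist G S x y = word_length G S (inv\<^bsub>G\<^esub> x \<otimes>\<^bsub>G\<^esub> y)"

definition word_sphere :: "('a, 'm) monoid_scheme \<Rightarrow> 'a set \<Rightarrow> nat \<Rightarrow> 'a set" where
  "word_sphere G S n = {x \<in> carrier G. word_dist G S \<one>\<^bsub>G\<^esub> x = n}"

definition growth_function :: "('a, 'm) monoid_scheme \<Rightarrow> 'a set \<Rightarrow> nat \<Rightarrow> nat" where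
  "growth_function G S n = card {x \<in> carrier G. word_dist G S \<one>\<^bsub>G\<^esub> x \<le> n}"

definition growth_rate :: "('a, 'm) monoid_scheme \<Rightarrow> 'a set \<Rightarrow> real" where
  "growth_rate G S = lim (\<lambda>n. root n (real (growth_function G S n)))"

definition subexponential_growth :: "('a, 'm) monoid_scheme \<Rightarrow> 'a set \<Rightarrow> bool" where
  "subexponential_growth G S \<longleftrightarrow> growth_rate G S = 1"

definition growth_dominates ::
  "('a, 'm) monoid_scheme \<Rightarrow> 'a set \<Rightarrow> ('b, 'n) monoid_scheme \<Rightarrow> 'b set \<Rightarrow> bool" where
  "growth_dominates H T K U \<longleftrightarrow>
     subexponential_growth K U \<or> growth_rate K U < growth_rate H T"

definition mean_sphere_dist :: "('a, 'm) monoid_scheme \<Rightarrow> 'a set \<Rightarrow> nat \<Rightarrow> real" where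
  "mean_sphere_dist G S n =
     1 / (real (card (word_sphere G S n)))\<^sup>2 *
     (\<Sum>x\<in>word_sphere G S n. \<Sum>y\<in>word_sphere G S n. 1 / real n * real (word_dist G S x y))"

definition sprawl :: "('a, 'm) monoid_scheme \<Rightarrow> 'a set \<Rightarrow> real" where
  "sprawl G S = lim (mean_sphere_dist G S)"

definition statistically_hyperbolic :: "('a, 'm) monoid_scheme \<Rightarrow> 'a set \<Rightarrow> bool" where
  "statistically_hyperbolic G S \<longleftrightarrow> convergent (mean_sphere_dist G S) \<and> sprawl G S = 2"

definition gromov_product :: "('a \<Rightarrow> 'a \<Rightarrow> real) \<Rightarrow> 'a \<Rightarrow> 'a \<Rightarrow> 'a \<Rightarrow> real" where
  "gromov_product d w x y = (d x w + d y w - d x y) / 2"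

definition gromov_hyperbolic_on :: "'a set \<Rightarrow> ('a \<Rightarrow> 'a \<Rightarrow> real) \<Rightarrow> bool" where
  "gromov_hyperbolic_on X d \<longleftrightarrow>
     (\<exists>\<delta>\<ge>0. \<forall>w\<in>X. \<forall>x\<in>X. \<forall>y\<in>X. \<forall>z\<in>X.
        gromov_product d w x z \<ge> min (gromov_product d w x y) (gromov_product d w y z) - \<delta>)"

(* Gromov's definition, applied to the group with its word metric.  This is the vertex set of
   the Cayley graph, from which every point of the graph has distance at most 1/2, so it is
   hyperbolic if and only if the Cayley graph is.  One finite generating set is asked for. *)
definition hyperbolic_group :: "('a, 'm) monoid_scheme \<Rightarrow> bool" where
  "hyperbolic_group G \<longleftrightarrow> group G \<and>
     (\<exists>S. finite_generating_set G S \<and>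
          gromov_hyperbolic_on (carrier G) (\<lambda>x y. real (word_dist G S x y)))"

definition non_elementary :: "('a, 'm) monoid_scheme \<Rightarrow> bool" where
  "non_elementary G \<longleftrightarrow> infinite (carrier G) \<and>
     \<not> (\<exists>g\<in>carrier G. finite (rcosets\<^bsub>G\<^esub> (generate G {g})))"

definition split_set ::
  "('a, 'm) monoid_scheme \<Rightarrow> ('b, 'n) monoid_scheme \<Rightarrow> ('a \<times> 'b) set \<Rightarrow> bool" where
  "split_set H K S \<longleftrightarrow> (\<forall>s\<in>S. fst s = \<one>\<^bsub>H\<^esub> \<or> snd s = \<one>\<^bsub>K\<^esub>)"

end

theory Submission
  imports Defs "HOL-Real_Asymp.Real_Asymp"
begin

text \<open>As \<open>S\<close> is split, lengths in \<open>H \<times> K\<close> add up. Let \<open>\<lambda>\<close> be the growth rate of \<open>H\<close>. It exceeds 1: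
  a tripod, that is three long elements with small pairwise Gromov products, generates a binary
  tree of distinct elements; and if \<open>g\<close> is loxodromic and \<open>H\<close> is not virtually cyclic, then large
  powers of \<open>g\<close> and \<open>g\<^sup>-\<^sup>1\<close> together with an element far from the axis of \<open>g\<close> form a tripod. So the
  growth rate of \<open>K\<close> is less than \<open>\<lambda>\<close> in either case, and in a sphere of radius \<open>n\<close> all but an exponentially
  small proportion of the pairs have \<open>K\<close>-components of length less than \<open>\<eta> n\<close>. Finally, an element
  \<open>h'\<close> whose Gromov product with \<open>h\<close> is at least \<open>\<eta> n\<close> factors as a point of a geodesic to \<open>h\<close>, an
  element of length \<open>o(n)\<close>, and an element of length at most \<open>|h'| - \<eta> n + o(n)\<close>. Such pairs are
  exponentially rare too, so typical distances are at least \<open>(2 - 4\<eta>) n\<close>.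

  Hyperbolicity is given for some other generating set, but errors \<open>o(n)\<close> are harmless, so the
  Morse lemma is only needed with a logarithmic bound, which follows by bisecting paths.\<close>

section \<open>Word norms\<close>

text \<open>The properties of a word length that the geometry uses, detached from any generating
  set, so that the same lemmas serve \<open>K\<close> and both lengths on \<open>H\<close>. The
  axiom \<open>norm_split\<close> replaces geodesics: an element can be cut at any prescribed
  length.\<close>

locale word_norm = group G for G (structure) +
  fixes l :: "'a \<Rightarrow> nat"
  assumes norm_one [simp]: "l \<one> = 0"
    and norm_zero: "\<lbrakk>x \<in> carrier G; l x = 0\<rbrakk> \<Longrightarrow> x = \<one>"
    and norm_inv [simp]: "x \<in> carrier G \<Longrightarrow> l (inv x) = l x"
    and norm_mult: "\<lbrakk>x \<in> carrier G; y \<in> carrier G\<rbrakk> \<Longrightarrow> l (x \<otimes> y) \<le> l x + l y"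
    and finite_ball: "finite {x \<in> carrier G. l x \<le> n}"
    and norm_split: "\<lbrakk>x \<in> carrier G; l x = a + b\<rbrakk> \<Longrightarrow>
      \<exists>y\<in>carrier G. \<exists>z\<in>carrier G. x = y \<otimes> z \<and> l y = a \<and> l z = b"

section \<open>Words, their values and shortest words\<close>

context group
begin

lemma word_value_closed:
  "set ws \<subseteq> carrier G \<Longrightarrow> word_value G ws \<in> carrier G"
  by (induction ws) (auto simp: word_value_def)

lemma word_value_Nil [simp]: "word_value G [] = \<one>"
  by (simp add: word_value_def)

lemma word_value_Cons [simp]: "word_value G (a # ws) = a \<otimes> word_value G ws"
  by (simp add: word_value_def)

lemma word_value_append:
  "\<lbrakk>set us \<subseteq> carrier G; set ws \<subseteq> carrier G\<rbrakk>
    \<Longrightarrow> word_value G (us @ ws) = word_value G us \<otimes> word_value G ws"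
  by (induction us) (auto simp: word_value_closed m_assoc)

lemma word_value_rev_inv:
  "set ws \<subseteq> carrier G \<Longrightarrow> word_value G (rev (map (m_inv G) ws)) = inv (word_value G ws)"
proof (induction ws)
  case (Cons a ws)
  have s: "set (rev (map (m_inv G) ws)) \<subseteq> carrier G"
    using Cons.prems by auto
  show ?case
    using Cons.prems Cons.IH s
    by (simp add: word_value_append inv_mult_group word_value_closed)
qed auto

end

text \<open>Generation is stated through words because \<open>word_length\<close> is a
  \<open>LEAST\<close>, which is informative only when some word exists.\<close>

locale word_generated = group G for G (structure) +
  fixes S
  assumes finite_gens: "finite S"
    and gens_closed: "S \<subseteq> carrier G"
    and word_exists: "x \<in> carrier G \<Longrightarrow> \<exists>ws. set ws \<subseteq> S \<union> m_inv G ` S \<and> word_value G ws = x"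
begin

abbreviation "letters \<equiv> S \<union> m_inv G ` S"

lemma letters_closed: "letters \<subseteq> carrier G"
  using gens_closed by auto

lemma finite_letters: "finite letters"
  using finite_gens by auto

lemma inv_letters: "a \<in> letters \<Longrightarrow> inv a \<in> letters"
  using gens_closed by (auto simp: subset_iff)

lemma word_length_le:
  assumes "set ws \<subseteq> letters" "word_value G ws = x"
  shows "word_length G S x \<le> length ws"
  unfolding word_length_def by (rule Least_le) (use assms in auto)

lemma geodesic_word:
  assumes "x \<in> carrier G"
  obtains ws where "length ws = word_length G S x" "set ws \<subseteq> letters" "word_value G ws = x"
proof -
  have "\<exists>n ws. length ws = n \<and> set ws \<subseteq> letters \<and> word_value G ws = x"
    using word_exists[OF assms] by auto
  from LeastI_ex[OF this] show ?thesis
    using that unfolding word_length_def by auto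
qed

text \<open>Spell \<open>x\<close> by a geodesic word and apply subadditivity letter by letter. This
  yields both inequalities for split products and the comparison of two generating sets.\<close>

lemma lipschitz_word_length:
  fixes f :: "_ \<Rightarrow> nat"
  assumes one: "f \<one> = 0"
    and sub: "\<And>x y. \<lbrakk>x \<in> carrier G; y \<in> carrier G\<rbrakk> \<Longrightarrow> f (x \<otimes> y) \<le> f x + f y"
    and letter: "\<And>a. a \<in> letters \<Longrightarrow> f a \<le> C"
    and x: "x \<in> carrier G"
  shows "f x \<le> C * word_length G S x"
proof -
  have *: "f (word_value G ws) \<le> C * length ws" if "set ws \<subseteq> letters" for ws
    using that
  proof (induction ws)
    case (Cons a ws)
    have "f (a \<otimes> word_value G ws) \<le> f a + f (word_value G ws)"
      using Cons.prems letters_closed by (intro sub word_value_closed) auto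
    also have "\<dots> \<le> C + C * length ws"
      using Cons letter[of a] by (intro add_mono) auto
    finally show ?case by simp
  qed (simp add: one)
  obtain ws where "length ws = word_length G S x" "set ws \<subseteq> letters" "word_value G ws = x"
    using geodesic_word[OF x] .
  with *[of ws] show ?thesis by simp
qed

lemma word_length_one: "word_length G S \<one> = 0"
  using word_length_le[of "[]" \<one>] by simp

lemma word_length_zero:
  assumes "x \<in> carrier G" "word_length G S x = 0"
  shows "x = \<one>"
  using geodesic_word[OF assms(1)] assms(2) by (metis length_0_conv word_value_Nil)

lemma word_length_letter: "a \<in> letters \<Longrightarrow> word_length G S a \<le> 1"
  using word_length_le[of "[a]" a] letters_closed by auto

lemma word_length_inv_le:
  assumes "x \<in> carrier G"
  shows "word_length G S (inv x) \<le> word_length G S x"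
proof -
  obtain ws where ws: "length ws = word_length G S x" "set ws \<subseteq> letters" "word_value G ws = x"
    using geodesic_word[OF assms] .
  have "set (rev (map (m_inv G) ws)) \<subseteq> letters"
    using ws(2) inv_letters by (auto simp del: Un_iff)
  moreover have "word_value G (rev (map (m_inv G) ws)) = inv x"
    using ws letters_closed by (subst word_value_rev_inv) auto
  ultimately show ?thesis
    using word_length_le ws(1) by fastforce
qed

lemma word_length_inv:
  assumes "x \<in> carrier G"
  shows "word_length G S (inv x) = word_length G S x"
  using word_length_inv_le[OF assms] word_length_inv_le[of "inv x"] assms by simp

lemma word_length_mult:
  assumes "x \<in> carrier G" "y \<in> carrier G"
  shows "word_length G S (x \<otimes> y) \<le> word_length G S x + word_length G S y"
proof -
  obtain us where us: "length us = word_length G S x" "set us \<subseteq> letters" "word_value G us = x"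
    using geodesic_word[OF assms(1)] .
  obtain ws where ws: "length ws = word_length G S y" "set ws \<subseteq> letters" "word_value G ws = y"
    using geodesic_word[OF assms(2)] .
  have "word_value G (us @ ws) = x \<otimes> y"
    using us ws letters_closed by (subst word_value_append) auto
  then have "word_length G S (x \<otimes> y) \<le> length (us @ ws)"
    using us ws by (intro word_length_le) auto
  then show ?thesis using us ws by simp
qed

text \<open>Cut a geodesic word after \<open>a\<close> letters. The pieces have lengths at most
  \<open>a\<close> and \<open>b\<close>, and subadditivity forces equality.\<close>

lemma word_length_split:
  assumes x: "x \<in> carrier G" and ab: "word_length G S x = a + b"
  shows "\<exists>y\<in>carrier G. \<exists>z\<in>carrier G. x = y \<otimes> z \<and> word_length G S y = a \<and> word_length G S z = b"
proof -
  obtain ws where ws: "length ws = word_length G S x" "set ws \<subseteq> letters" "word_value G ws = x"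
    using geodesic_word[OF x] .
  define us where "us = take a ws"
  define vs where "vs = drop a ws"
  have len: "length us = a" "length vs = b"
    using ws ab by (auto simp: us_def vs_def)
  have sets: "set us \<subseteq> letters" "set vs \<subseteq> letters"
    using ws(2) set_take_subset[of a ws] set_drop_subset[of a ws] unfolding us_def vs_def by blast+
  define y where "y = word_value G us"
  define z where "z = word_value G vs"
  have yz: "y \<in> carrier G" "z \<in> carrier G"
    unfolding y_def z_def using sets letters_closed by (auto intro!: word_value_closed)
  have "ws = us @ vs" by (simp add: us_def vs_def)
  then have xyz: "x = y \<otimes> z"
    using ws(3) sets letters_closed word_value_append[of us vs] by (auto simp: y_def z_def)
  have "word_length G S y \<le> a" "word_length G S z \<le> b"
    using word_length_le[OF sets(1)] word_length_le[OF sets(2)] len by (auto simp: y_def z_def)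
  moreover have "a + b \<le> word_length G S y + word_length G S z"
    using word_length_mult[OF yz] ab xyz by simp
  ultimately show ?thesis
    using yz xyz by (intro bexI[of _ y] bexI[of _ z]) auto
qed

lemma finite_word_ball: "finite {x \<in> carrier G. word_length G S x \<le> n}"
proof -
  have "{x \<in> carrier G. word_length G S x \<le> n}
      \<subseteq> word_value G ` {ws. set ws \<subseteq> letters \<and> length ws \<le> n}"
    using geodesic_word by (smt (verit) image_iff mem_Collect_eq subsetI)
  then show ?thesis
    using finite_lists_length_le[OF finite_letters] finite_surj by blast
qed

sublocale norm: word_norm G "word_length G S"
  by unfold_locales
    (simp_all add: word_length_one word_length_zero word_length_inv word_length_mult finite_word_ball word_length_split)

lemma word_dist_one: "x \<in> carrier G \<Longrightarrow> word_dist G S \<one> x = word_length G S x"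
  by (simp add: word_dist_def)

end

lemma word_generatedI:
  assumes "group G" "finite_generating_set G S"
  shows "word_generated G S"
proof -
  interpret group G by fact
  have S: "finite S" "S \<subseteq> carrier G" "generate G S = carrier G"
    using assms(2) by (auto simp: finite_generating_set_def)
  show ?thesis
  proof unfold_locales
    fix x assume "x \<in> carrier G"
    then have "x \<in> generate G S" using S by simp
    then show "\<exists>ws. set ws \<subseteq> S \<union> m_inv G ` S \<and> word_value G ws = x"
    proof induction
      case one
      show ?case by (intro exI[of _ "[]"]) auto
    next
      case (incl h)
      then show ?case using S by (intro exI[of _ "[h]"]) auto
    next
      case (inv h)
      then show ?case using S by (intro exI[of _ "[inv\<^bsub>G\<^esub> h]"]) auto
    next
      case (eng h1 h2)
      then obtain us ws where "set us \<subseteq> S \<union> m_inv G ` S" "word_value G us = h1"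
        "set ws \<subseteq> S \<union> m_inv G ` S" "word_value G ws = h2" by blast
      moreover from this have "set us \<subseteq> carrier G" "set ws \<subseteq> carrier G"
        using S by auto
      ultimately show ?case
        by (intro exI[of _ "us @ ws"]) (simp add: word_value_append)
    qed
  qed (use S in auto)
qed

section \<open>Split generating sets of a direct product\<close>

locale split_product = H: group H + K: group K + word_generated "H \<times>\<times> K" S
  for H (structure) and K (structure) and S +
  assumes split: "split_set H K S"
begin

lemma word_value_DirProd:
  "set ws \<subseteq> carrier (H \<times>\<times> K) \<Longrightarrow>
    word_value (H \<times>\<times> K) ws = (word_value H (map fst ws), word_value K (map snd ws))"
  by (induction ws) (auto simp: DirProd_def word_value_def split: prod.splits)

lemma fst_letters: "fst ` letters \<subseteq> fst ` S \<union> m_inv H ` fst ` S"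
proof
  fix a assume "a \<in> fst ` letters"
  then obtain s where s: "s \<in> S" "a = fst s \<or> a = fst (inv\<^bsub>H \<times>\<times> K\<^esub> s)" by auto
  then have "s \<in> carrier (H \<times>\<times> K)" using gens_closed by auto
  then have "fst (inv\<^bsub>H \<times>\<times> K\<^esub> s) = inv\<^bsub>H\<^esub> fst s"
    using inv_DirProd[OF H.group_axioms K.group_axioms, of "fst s" "snd s"]
    by (auto simp: DirProd_def)
  with s show "a \<in> fst ` S \<union> m_inv H ` fst ` S" by auto
qed

lemma snd_letters: "snd ` letters \<subseteq> snd ` S \<union> m_inv K ` snd ` S"
proof
  fix a assume "a \<in> snd ` letters"
  then obtain s where s: "s \<in> S" "a = snd s \<or> a = snd (inv\<^bsub>H \<times>\<times> K\<^esub> s)" by auto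
  then have "s \<in> carrier (H \<times>\<times> K)" using gens_closed by auto
  then have "snd (inv\<^bsub>H \<times>\<times> K\<^esub> s) = inv\<^bsub>K\<^esub> snd s"
    using inv_DirProd[OF H.group_axioms K.group_axioms, of "fst s" "snd s"]
    by (auto simp: DirProd_def)
  with s show "a \<in> snd ` S \<union> m_inv K ` snd ` S" by auto
qed

sublocale H: word_generated H "fst ` S"
proof
  show "finite (fst ` S)" using finite_gens by simp
  show "fst ` S \<subseteq> carrier H" using gens_closed by (auto simp: DirProd_def)
  fix h assume "h \<in> carrier H"
  then obtain ws where ws: "set ws \<subseteq> letters" "word_value (H \<times>\<times> K) ws = (h, \<one>\<^bsub>K\<^esub>)"
    using word_exists[of "(h, \<one>\<^bsub>K\<^esub>)"] by (auto simp: DirProd_def)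
  then have "word_value H (map fst ws) = h"
    using letters_closed word_value_DirProd[of ws] by auto
  moreover have "set (map fst ws) \<subseteq> fst ` S \<union> m_inv H ` fst ` S"
    using image_mono[OF ws(1), of fst] fst_letters by simp
  ultimately show "\<exists>ws. set ws \<subseteq> fst ` S \<union> m_inv H ` fst ` S \<and> word_value H ws = h" by blast
qed

sublocale K: word_generated K "snd ` S"
proof
  show "finite (snd ` S)" using finite_gens by simp
  show "snd ` S \<subseteq> carrier K" using gens_closed by (auto simp: DirProd_def)
  fix k assume "k \<in> carrier K"
  then obtain ws where ws: "set ws \<subseteq> letters" "word_value (H \<times>\<times> K) ws = (\<one>\<^bsub>H\<^esub>, k)"
    using word_exists[of "(\<one>\<^bsub>H\<^esub>, k)"] by (auto simp: DirProd_def)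
  then have "word_value K (map snd ws) = k"
    using letters_closed word_value_DirProd[of ws] by auto
  moreover have "set (map snd ws) \<subseteq> snd ` S \<union> m_inv K ` snd ` S"
    using image_mono[OF ws(1), of snd] snd_letters by simp
  ultimately show "\<exists>ws. set ws \<subseteq> snd ` S \<union> m_inv K ` snd ` S \<and> word_value K ws = k" by blast
qed

lemma split_letters: "s \<in> letters \<Longrightarrow> fst s = \<one>\<^bsub>H\<^esub> \<or> snd s = \<one>\<^bsub>K\<^esub>"
proof -
  assume "s \<in> letters"
  then obtain t where t: "t \<in> S" "s = t \<or> s = inv\<^bsub>H \<times>\<times> K\<^esub> t" by blast
  then have c: "fst t \<in> carrier H" "snd t \<in> carrier K"
    using gens_closed by (auto simp: DirProd_def)
  have "inv\<^bsub>H \<times>\<times> K\<^esub> t = (inv\<^bsub>H\<^esub> fst t, inv\<^bsub>K\<^esub> snd t)"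
    using inv_DirProd[OF H.group_axioms K.group_axioms c] by simp
  then show ?thesis using t split by (auto simp: split_set_def)
qed

text \<open>A letter moves only one coordinate, so the sum of the two lengths grows by at most 1 per
  letter. Conversely, a nontrivial letter of a factor, paired with the identity, is a letter of the
  product, so the two coordinates can be spelled one after the other.\<close>

lemma word_length_split_product:
  assumes h: "h \<in> carrier H" and k: "k \<in> carrier K"
  shows "word_length (H \<times>\<times> K) S (h, k) = word_length H (fst ` S) h + word_length K (snd ` S) k"
proof (rule antisym)
  define f where "f = (\<lambda>(h, k). word_length H (fst ` S) h + word_length K (snd ` S) k)"
  have "f (h, k) \<le> 1 * word_length (H \<times>\<times> K) S (h, k)"
  proof (rule lipschitz_word_length)
    fix x y assume "x \<in> carrier (H \<times>\<times> K)" "y \<in> carrier (H \<times>\<times> K)"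
    then show "f (x \<otimes>\<^bsub>H \<times>\<times> K\<^esub> y) \<le> f x + f y"
      using H.word_length_mult[of "fst x" "fst y"] K.word_length_mult[of "snd x" "snd y"]
      by (auto simp: f_def DirProd_def split: prod.splits)
  next
    fix a assume a: "a \<in> letters"
    have "word_length H (fst ` S) (fst a) \<le> 1"
      by (rule H.word_length_letter, rule subsetD[OF fst_letters imageI[OF a]])
    moreover have "word_length K (snd ` S) (snd a) \<le> 1"
      by (rule K.word_length_letter, rule subsetD[OF snd_letters imageI[OF a]])
    ultimately show "f a \<le> 1"
      using split_letters[OF a] by (auto simp: f_def split: prod.splits)
  qed (use h k in \<open>auto simp: f_def\<close>)
  then show "word_length H (fst ` S) h + word_length K (snd ` S) k \<le> word_length (H \<times>\<times> K) S (h, k)"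
    by (simp add: f_def)
next
  \<comment> \<open>The identity is excluded: it may be the projection of a generator from the other
    factor, and the pair of identities need not be a letter.\<close>
  have inH: "(a, \<one>\<^bsub>K\<^esub>) \<in> letters" if a: "a \<in> fst ` S \<union> m_inv H ` fst ` S" "a \<noteq> \<one>\<^bsub>H\<^esub>" for a
  proof -
    obtain s where s: "s \<in> S" "a = fst s \<or> a = inv\<^bsub>H\<^esub> fst s" using a by auto
    then have c: "fst s \<in> carrier H" "snd s \<in> carrier K"
      using gens_closed by (auto simp: DirProd_def)
    have "fst s \<noteq> \<one>\<^bsub>H\<^esub>" using s a by auto
    then have sn: "snd s = \<one>\<^bsub>K\<^esub>" using split s by (auto simp: split_set_def)
    have "inv\<^bsub>H \<times>\<times> K\<^esub> s = (inv\<^bsub>H\<^esub> fst s, \<one>\<^bsub>K\<^esub>)"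
      using inv_DirProd[OF H.group_axioms K.group_axioms c] sn by (cases s) simp
    moreover have "s = (fst s, snd s)" by simp
    ultimately show ?thesis using s sn by (elim disjE) (auto intro: image_eqI[of _ _ s])
  qed
  have inK: "(\<one>\<^bsub>H\<^esub>, a) \<in> letters" if a: "a \<in> snd ` S \<union> m_inv K ` snd ` S" "a \<noteq> \<one>\<^bsub>K\<^esub>" for a
  proof -
    obtain s where s: "s \<in> S" "a = snd s \<or> a = inv\<^bsub>K\<^esub> snd s" using a by auto
    then have c: "fst s \<in> carrier H" "snd s \<in> carrier K"
      using gens_closed by (auto simp: DirProd_def)
    have "snd s \<noteq> \<one>\<^bsub>K\<^esub>" using s a by auto
    then have sn: "fst s = \<one>\<^bsub>H\<^esub>" using split s by (auto simp: split_set_def)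
    have "inv\<^bsub>H \<times>\<times> K\<^esub> s = (\<one>\<^bsub>H\<^esub>, inv\<^bsub>K\<^esub> snd s)"
      using inv_DirProd[OF H.group_axioms K.group_axioms c] sn by (cases s) simp
    moreover have "s = (fst s, snd s)" by simp
    ultimately show ?thesis using s sn by (elim disjE) (auto intro: image_eqI[of _ _ s])
  qed
  have one: "word_length (H \<times>\<times> K) S (\<one>\<^bsub>H\<^esub>, \<one>\<^bsub>K\<^esub>) = 0"
    using word_length_one by simp
  have "word_length (H \<times>\<times> K) S (h, \<one>\<^bsub>K\<^esub>) \<le> 1 * word_length H (fst ` S) h"
  proof (rule H.lipschitz_word_length)
    fix x y assume "x \<in> carrier H" "y \<in> carrier H"
    then show "word_length (H \<times>\<times> K) S (x \<otimes>\<^bsub>H\<^esub> y, \<one>\<^bsub>K\<^esub>)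
        \<le> word_length (H \<times>\<times> K) S (x, \<one>\<^bsub>K\<^esub>) + word_length (H \<times>\<times> K) S (y, \<one>\<^bsub>K\<^esub>)"
      using word_length_mult[of "(x, \<one>\<^bsub>K\<^esub>)" "(y, \<one>\<^bsub>K\<^esub>)"] by simp
  next
    fix a assume "a \<in> fst ` S \<union> m_inv H ` fst ` S"
    then show "word_length (H \<times>\<times> K) S (a, \<one>\<^bsub>K\<^esub>) \<le> 1"
      using inH[of a] word_length_letter one by (cases "a = \<one>\<^bsub>H\<^esub>") auto
  qed (use h one in auto)
  moreover have "word_length (H \<times>\<times> K) S (\<one>\<^bsub>H\<^esub>, k) \<le> 1 * word_length K (snd ` S) k"
  proof (rule K.lipschitz_word_length)
    fix x y assume "x \<in> carrier K" "y \<in> carrier K"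
    then show "word_length (H \<times>\<times> K) S (\<one>\<^bsub>H\<^esub>, x \<otimes>\<^bsub>K\<^esub> y)
        \<le> word_length (H \<times>\<times> K) S (\<one>\<^bsub>H\<^esub>, x) + word_length (H \<times>\<times> K) S (\<one>\<^bsub>H\<^esub>, y)"
      using word_length_mult[of "(\<one>\<^bsub>H\<^esub>, x)" "(\<one>\<^bsub>H\<^esub>, y)"] by simp
  next
    fix a assume "a \<in> snd ` S \<union> m_inv K ` snd ` S"
    then show "word_length (H \<times>\<times> K) S (\<one>\<^bsub>H\<^esub>, a) \<le> 1"
      using inK[of a] word_length_letter one by (cases "a = \<one>\<^bsub>K\<^esub>") auto
  qed (use k one in auto)
  moreover have "word_length (H \<times>\<times> K) S (h, k)
      \<le> word_length (H \<times>\<times> K) S (h, \<one>\<^bsub>K\<^esub>) + word_length (H \<times>\<times> K) S (\<one>\<^bsub>H\<^esub>, k)"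
    using word_length_mult[of "(h, \<one>\<^bsub>K\<^esub>)" "(\<one>\<^bsub>H\<^esub>, k)"] h k by simp
  ultimately show "word_length (H \<times>\<times> K) S (h, k)
      \<le> word_length H (fst ` S) h + word_length K (snd ` S) k" by linarith
qed

end

section \<open>Exponential growth of non-elementary hyperbolic groups\<close>

context word_norm
begin

text \<open>The Gromov product with base point \<open>\<one>\<close>. Other base points are reached
  by left translation: based at \<open>w\<close>, it is the product of
  \<open>inv w \<otimes> x\<close> and \<open>inv w \<otimes> y\<close>.\<close>

definition gprod :: "'a \<Rightarrow> 'a \<Rightarrow> real" where
  "gprod x y = (real (l x) + real (l y) - real (l (inv x \<otimes> y))) / 2"

lemma norm_inv_mult_commute:
  "\<lbrakk>x \<in> carrier G; y \<in> carrier G\<rbrakk> \<Longrightarrow> l (inv x \<otimes> y) = l (inv y \<otimes> x)"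
  using norm_inv[of "inv x \<otimes> y"] by (simp add: inv_mult_group)

lemma gprod_commute: "\<lbrakk>x \<in> carrier G; y \<in> carrier G\<rbrakk> \<Longrightarrow> gprod x y = gprod y x"
  by (simp add: gprod_def norm_inv_mult_commute)

lemma gprod_nonneg: "\<lbrakk>x \<in> carrier G; y \<in> carrier G\<rbrakk> \<Longrightarrow> 0 \<le> gprod x y"
  using norm_mult[of "inv x" y] by (simp add: gprod_def)

lemma gprod_le_left:
  assumes "x \<in> carrier G" "y \<in> carrier G"
  shows "gprod x y \<le> l x"
proof -
  have "y = x \<otimes> (inv x \<otimes> y)"
    using assms by (simp flip: m_assoc)
  then have "l y \<le> l x + l (inv x \<otimes> y)"
    using norm_mult[of x "inv x \<otimes> y"] assms by simp
  then show ?thesis by (simp add: gprod_def)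
qed

lemma gprod_self: "x \<in> carrier G \<Longrightarrow> gprod x x = l x"
  by (simp add: gprod_def)

lemma norm_mult_eq:
  "\<lbrakk>x \<in> carrier G; y \<in> carrier G\<rbrakk> \<Longrightarrow> real (l (x \<otimes> y)) = real (l x) + real (l y) - 2 * gprod (inv x) y"
  by (simp add: gprod_def field_simps)

text \<open>In the triangle \<open>\<one>\<close>, \<open>x\<close>, \<open>x \<otimes> y\<close>
  the Gromov products at the two ends of a side add up to the length of that side. The product at
  \<open>x\<close>, moved to the identity, is \<open>gprod (inv x) y\<close>.\<close>

lemma gprod_mult_right:
  assumes "x \<in> carrier G" "y \<in> carrier G"
  shows "gprod x (x \<otimes> y) = l x - gprod (inv x) y"
proof -
  have "inv x \<otimes> (x \<otimes> y) = y"
    using assms by (simp flip: m_assoc)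
  then show ?thesis
    using assms by (simp add: gprod_def field_simps)
qed

lemma gprod_le_half:
  assumes "x \<in> carrier G" "y \<in> carrier G" "l y \<le> l (inv x \<otimes> y)"
  shows "gprod x y \<le> l x / 2"
  using assms by (simp add: gprod_def)

lemma unbounded_norm:
  assumes "infinite (carrier G)"
  shows "\<exists>x\<in>carrier G. l x = n"
proof -
  have "\<not> carrier G \<subseteq> {x \<in> carrier G. l x \<le> n}"
    using finite_ball[of n] assms finite_subset by blast
  then obtain x where x: "x \<in> carrier G" "\<not> l x \<le> n" by blast
  then have "l x = n + (l x - n)" by simp
  from norm_split[OF x(1) this] show ?thesis by auto
qed

end

text \<open>Gromov's four-point condition at the base point \<open>\<one>\<close> only; left
  invariance of the metric gives it at every other point.\<close>

locale hyperbolic_norm = word_norm +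
  fixes \<delta> :: real
  assumes delta_nonneg: "0 \<le> \<delta>"
    and gprod_ge_min: "\<lbrakk>x \<in> carrier G; y \<in> carrier G; z \<in> carrier G\<rbrakk> \<Longrightarrow>
      gprod x z \<ge> min (gprod x y) (gprod y z) - \<delta>"
begin

text \<open>If \<open>y\<close> and \<open>z\<close> had a larger product, the four-point condition
  would push \<open>gprod x z\<close> above \<open>c\<close>. In use: an element that follows
  \<open>x\<close> long enough inherits the small products of \<open>x\<close>, at the price of one
  \<delta>.\<close>

lemma gprod_le_cancel:
  assumes "x \<in> carrier G" "y \<in> carrier G" "z \<in> carrier G"
    and "gprod x z \<le> c" "gprod x y > c + \<delta>"
  shows "gprod y z \<le> c + \<delta>"
  using gprod_ge_min[of x y z] assms by linarith

text \<open>A word whose letters are long compared with the Gromov products at its turns is a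
  quasi-geodesic: the products do not accumulate.\<close>

definition gentle :: "real \<Rightarrow> real \<Rightarrow> 'a list \<Rightarrow> bool" where
  "gentle M N ws \<longleftrightarrow> set ws \<subseteq> carrier G \<and> (\<forall>s\<in>set ws. N \<le> l s) \<and>
     successively (\<lambda>s t. gprod (inv s) t \<le> M) ws"

lemma gentle_Cons: "gentle M N (s # ws) \<Longrightarrow> s \<in> carrier G \<and> N \<le> l s \<and> gentle M N ws"
  by (auto simp: gentle_def successively_Cons)

lemma gentle_closed: "gentle M N ws \<Longrightarrow> word_value G ws \<in> carrier G"
  by (auto simp: gentle_def word_value_closed)

text \<open>Induction on the tail. By the induction hypothesis the value of \<open>t # ws\<close>
  follows its first letter \<open>t\<close> for more than \<open>M + \<delta>\<close>, so its
  product with \<open>inv s\<close> is at most that of \<open>t\<close> plus \<delta>. The error is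
  still a single \<delta>, since each stage starts afresh from the bound \<open>M\<close> for
  adjacent letters.\<close>

lemma gentle_turn:
  assumes "gentle M N (s # ws)" and M: "0 \<le> M" and N: "2 * M + 2 * \<delta> < N"
  shows "gprod (inv s) (word_value G ws) \<le> M + \<delta>"
  using assms(1)
proof (induction ws arbitrary: s)
  case Nil
  then show ?case
    using M delta_nonneg by (auto simp: gprod_def gentle_def)
next
  case (Cons t ws)
  have g: "gentle M N (t # ws)" and s: "s \<in> carrier G" and st: "gprod (inv s) t \<le> M"
    using Cons.prems by (auto simp: gentle_def)
  have t: "t \<in> carrier G" "N \<le> l t" and w: "word_value G ws \<in> carrier G"
    using gentle_Cons[OF g] gentle_closed by auto
  have "gprod t (t \<otimes> word_value G ws) = l t - gprod (inv t) (word_value G ws)"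
    by (rule gprod_mult_right[OF t(1) w])
  moreover have "gprod (inv t) (word_value G ws) \<le> M + \<delta>"
    by (rule Cons.IH[OF g])
  ultimately have "gprod t (t \<otimes> word_value G ws) > M + \<delta>"
    using t N by linarith
  moreover have "gprod t (inv s) \<le> M"
    using st s t by (simp add: gprod_commute)
  ultimately have "gprod (t \<otimes> word_value G ws) (inv s) \<le> M + \<delta>"
    using s t w by (intro gprod_le_cancel[of t]) auto
  then show ?case
    using s t w by (simp add: gprod_commute)
qed

lemma gentle_head:
  assumes "gentle M N (s # ws)" "0 \<le> M" "2 * M + 2 * \<delta> < N"
  shows "gprod s (word_value G (s # ws)) \<ge> N - M - \<delta>"
proof -
  have "s \<in> carrier G" "N \<le> l s" "word_value G ws \<in> carrier G"
    using gentle_Cons[OF assms(1)] gentle_closed by auto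
  then show ?thesis
    using gentle_turn[OF assms] gprod_mult_right[of s "word_value G ws"] by simp
qed

lemma gentle_norm:
  assumes "gentle M N ws" "0 \<le> M" "2 * M + 2 * \<delta> < N"
  shows "real (l (word_value G ws)) \<ge> length ws * (N - 2 * M - 2 * \<delta>)"
  using assms(1)
proof (induction ws)
  case (Cons s ws)
  have *: "s \<in> carrier G" "N \<le> l s" "gentle M N ws" "word_value G ws \<in> carrier G"
    using gentle_Cons[OF Cons.prems] gentle_closed by auto
  have "real (l (s \<otimes> word_value G ws)) = real (l s) + real (l (word_value G ws)) - 2 * gprod (inv s) (word_value G ws)"
    using * by (simp add: norm_mult_eq)
  then have "real (l (s \<otimes> word_value G ws)) \<ge> N + length ws * (N - 2 * M - 2 * \<delta>) - 2 * (M + \<delta>)"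
    using Cons.IH[OF *(3)] gentle_turn[OF Cons.prems assms(2,3)] *(2) by simp
  then show ?case by (simp add: algebra_simps)
qed simp

text \<open>By \<open>gentle_head\<close> the common value follows the first letter of each word for
  at least \<open>N - M - 2 * \<delta>\<close>. Two different first letters would then have a
  product above \<open>M\<close>; hence they agree and can be cancelled.\<close>

lemma gentle_value_inject:
  assumes "gentle (M + \<delta>) N us" "gentle (M + \<delta>) N vs" "length us = length vs"
    and "word_value G us = word_value G vs"
    and "set us \<subseteq> T" "set vs \<subseteq> T"
    and T: "\<And>s t. \<lbrakk>s \<in> T; t \<in> T; s \<noteq> t\<rbrakk> \<Longrightarrow> gprod s t \<le> M"
    and M: "0 \<le> M" and N: "2 * M + 4 * \<delta> < N"
  shows "us = vs"
  using assms(3) assms(1,2,4-6)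
proof (induction us vs rule: list_induct2)
  case (Cons s us t vs)
  let ?v = "word_value G (s # us)"
  have *: "s \<in> carrier G" "gentle (M + \<delta>) N us" "word_value G us \<in> carrier G"
    "t \<in> carrier G" "gentle (M + \<delta>) N vs" "word_value G vs \<in> carrier G"
    using gentle_Cons[OF Cons.prems(1)] gentle_Cons[OF Cons.prems(2)] gentle_closed by auto
  have "s = t"
  proof (rule ccontr)
    assume "s \<noteq> t"
    then have "gprod s t \<le> M" using Cons.prems T by auto
    moreover have "gprod s ?v \<ge> N - (M + \<delta>) - \<delta>"
      using M N delta_nonneg by (intro gentle_head Cons.prems) auto
    moreover have "gprod t (word_value G (t # vs)) \<ge> N - (M + \<delta>) - \<delta>"
      using M N delta_nonneg by (intro gentle_head Cons.prems) auto
    moreover have "gprod s t \<ge> min (gprod s ?v) (gprod ?v t) - \<delta>"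
      using * by (intro gprod_ge_min) auto
    moreover have "gprod ?v t = gprod t (word_value G (t # vs))"
      using * Cons.prems(3) by (metis gprod_commute m_closed word_value_Cons)
    ultimately show False using N delta_nonneg by linarith
  qed
  moreover have "word_value G us = word_value G vs"
    using Cons.prems(3) * \<open>s = t\<close> by simp
  ultimately show ?case
    using Cons.IH * Cons.prems by auto
qed simp

text \<open>After each letter at least two of the three elements continue without a sharp turn, so a
  tripod generates a binary tree of distinct values.\<close>

lemma tripod_imp_exponential_growth:
  fixes M N :: real
  assumes T: "T \<subseteq> carrier G" "card T = 3"
    and prod: "\<And>s t. \<lbrakk>s \<in> T; t \<in> T; s \<noteq> t\<rbrakk> \<Longrightarrow> gprod s t \<le> M"
    and long: "\<And>s. s \<in> T \<Longrightarrow> N \<le> l s"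
    and M: "0 \<le> M" and N: "2 * M + 4 * \<delta> < N"
  shows "\<exists>L. \<forall>m. 2 ^ m \<le> card {v \<in> carrier G. l v \<le> m * L}"
proof -
  obtain x y z where xyz: "T = {x, y, z}" "x \<noteq> y" "y \<noteq> z" "x \<noteq> z"
    using T(2) by (auto simp: card_3_iff)
  define ok where "ok s t \<longleftrightarrow> gprod (inv s) t \<le> M + \<delta>" for s t
  \<comment> \<open>If both turns were sharp, \<open>t\<close> and \<open>t'\<close> would each
    follow \<open>inv s\<close> for more than \<open>M + \<delta>\<close>, and so each other for
    more than \<open>M\<close>.\<close>
  have two: "ok s t \<or> ok s t'" if "s \<in> T" "t \<in> T" "t' \<in> T" "t \<noteq> t'" for s t t'
  proof -
    have "gprod t t' \<ge> min (gprod t (inv s)) (gprod (inv s) t') - \<delta>"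
      using that T by (intro gprod_ge_min) auto
    moreover have "gprod t (inv s) = gprod (inv s) t"
      using that T by (intro gprod_commute) auto
    ultimately show ?thesis using prod[of t t'] that by (auto simp: ok_def)
  qed
  have "\<exists>f. f True \<in> T \<and> f False \<in> T \<and> f True \<noteq> f False \<and> (\<forall>b. ok s (f b))"
    if s: "s \<in> T" for s
  proof -
    have "\<exists>t\<in>T. \<exists>t'\<in>T. t \<noteq> t' \<and> ok s t \<and> ok s t'"
      using two[OF s, of x y] two[OF s, of y z] two[OF s, of x z] xyz by auto
    then obtain t t' where "t \<in> T" "t' \<in> T" "t \<noteq> t'" "ok s t" "ok s t'" by auto
    then show ?thesis by (intro exI[of _ "\<lambda>b. if b then t else t'"]) auto
  qed
  then obtain f where f: "\<And>s. s \<in> T \<Longrightarrow>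
      f s True \<in> T \<and> f s False \<in> T \<and> f s True \<noteq> f s False \<and> (\<forall>b. ok s (f s b))"
    by metis
  have fT: "f s b \<in> T" "ok s (f s b)" if "s \<in> T" for s b
    using f[OF that] by (cases b; simp)+
  \<comment> \<open>Each bit selects one of the two permitted continuations of the current letter.
    The starting letter \<open>s\<close> only constrains the first turn and is not part of the
    word.\<close>
  define walk where "walk = rec_list (\<lambda>s. []) (\<lambda>b bs w s. f s b # w (f s b))"
  have walk: "walk [] s = []" "walk (b # bs) s = f s b # walk bs (f s b)" for s b bs
    by (simp_all add: walk_def)
  have len: "length (walk bs s) = length bs" for bs s
    by (induction bs arbitrary: s) (auto simp: walk)
  have setT: "set (walk bs s) \<subseteq> T" if "s \<in> T" for bs s
    using that by (induction bs arbitrary: s) (auto simp: walk fT)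
  have succ: "successively ok (s # walk bs s)" if "s \<in> T" for bs s
    using that by (induction bs arbitrary: s) (auto simp: walk fT)
  have gentle: "gentle (M + \<delta>) N (walk bs s)" if "s \<in> T" for bs s
    using setT[OF that, of bs] succ[OF that, of bs] T long
    by (auto simp: gentle_def successively_Cons ok_def subset_iff)
  have inj: "bs = bs'" if "s \<in> T" "length bs = length bs'" "walk bs s = walk bs' s" for bs bs' s
    using that(2,1,3)
  proof (induction bs bs' arbitrary: s rule: list_induct2)
    case (Cons b bs b' bs')
    have "b = b'"
      using Cons.prems f[OF Cons.prems(1)] by (cases b; cases b') (auto simp: walk)
    then show ?case using Cons.prems Cons.IH[of "f s b"] fT by (auto simp: walk)
  qed simp
  define L where "L = Max (l ` T)"
  have finT: "finite T" using xyz by simp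
  have value_le: "l (word_value G ws) \<le> length ws * L" if "set ws \<subseteq> T" for ws
    using that
  proof (induction ws)
    case (Cons s ws)
    have "l (s \<otimes> word_value G ws) \<le> l s + l (word_value G ws)"
      using Cons.prems T by (intro norm_mult word_value_closed) auto
    moreover have "l s \<le> L"
      using Cons.prems finT by (auto simp: L_def)
    ultimately show ?case using Cons by simp
  qed simp
  have xT: "x \<in> T" using xyz by simp
  have "2 ^ m \<le> card {v \<in> carrier G. l v \<le> m * L}" for m
  proof -
    let ?B = "{bs :: bool list. length bs = m}"
    have card_B: "card ?B = 2 ^ m"
      using card_lists_length_eq[of "UNIV :: bool set" m] by simp
    have "inj_on (\<lambda>bs. word_value G (walk bs x)) ?B"
    proof (rule inj_onI)
      fix bs bs' assume *: "bs \<in> ?B" "bs' \<in> ?B" "word_value G (walk bs x) = word_value G (walk bs' x)"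
      have "walk bs x = walk bs' x"
        by (rule gentle_value_inject[OF gentle gentle _ _ setT setT prod]) (use * xT len M N in auto)
      then show "bs = bs'" using inj[OF xT] * by auto
    qed
    then have "card ?B = card ((\<lambda>bs. word_value G (walk bs x)) ` ?B)"
      by (simp add: card_image)
    also have "\<dots> \<le> card {v \<in> carrier G. l v \<le> m * L}"
    proof (rule card_mono[OF finite_ball])
      show "(\<lambda>bs. word_value G (walk bs x)) ` ?B \<subseteq> {v \<in> carrier G. l v \<le> m * L}"
      using value_le[OF setT[OF xT]] len gentle_closed[OF gentle[OF xT]] by auto
    qed
    finally show ?thesis by (simp add: card_B)
  qed
  then show ?thesis by blast
qed

text \<open>If \<open>x\<close> and \<open>y\<close> point in opposite directions and neither of them is loxodromic, then
  their product is.\<close>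

lemma exists_loxodromic:
  assumes "infinite (carrier G)"
  shows "\<exists>g\<in>carrier G. 2 * gprod (inv g) g + D \<le> l g"
proof (rule ccontr)
  assume neg: "\<not> ?thesis"
  then have ell: "gprod (inv g) g > (l g - D) / 2" if "g \<in> carrier G" for g
    using that by force
  obtain n :: nat where n: "real n > \<bar>D\<bar> + 8 * \<delta>"
    using reals_Archimedean2 by blast
  obtain w where w: "w \<in> carrier G" "l w = n + n"
    using unbounded_norm[OF assms] by blast
  obtain x' y where xy': "x' \<in> carrier G" "y \<in> carrier G" "w = x' \<otimes> y" "l x' = n" "l y = n"
    using norm_split[OF w] by blast
  \<comment> \<open>Seen from the midpoint of the geodesic word for \<open>w\<close>, its two ends
    are \<open>x\<close> and \<open>y\<close>, which therefore have Gromov product 0.\<close>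
  define x where "x = inv x'"
  have x: "x \<in> carrier G" "l x = n" and y: "y \<in> carrier G" "l y = n"
    using xy' by (auto simp: x_def)
  note ix = inv_closed[OF x(1)] and iy = inv_closed[OF y(1)]
  have xy: "gprod x y = 0"
    using xy' w by (simp add: x_def gprod_def)
  \<comment> \<open>As \<open>x\<close> is not loxodromic, it follows \<open>inv x\<close> for more
    than \<delta>, so \<open>inv x\<close> inherits the zero product of \<open>x\<close> with
    \<open>y\<close>. The next step exchanges the roles of \<open>x\<close> and
    \<open>y\<close>.\<close>
  have ixy: "gprod (inv x) y \<le> \<delta>"
    using gprod_le_cancel[of x "inv x" y 0] x y ix xy ell[OF x(1)] n delta_nonneg
    by (simp add: gprod_commute)
  have xiy: "gprod (inv y) x \<le> \<delta>"
    using gprod_le_cancel[of y "inv y" x 0] x y iy xy ell[OF y(1)] n delta_nonneg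
    by (simp add: gprod_commute)
  define g where "g = x \<otimes> y"
  have g: "g \<in> carrier G" using x y by (simp add: g_def)
  have lg: "l g \<ge> 2 * n - 2 * \<delta>"
    using norm_mult_eq[OF x(1) y(1)] ixy x y by (simp add: g_def)
  have xg: "gprod x g \<ge> n - \<delta>"
    using gprod_mult_right[OF x(1) y(1)] ixy x by (simp add: g_def)
  have "gprod (inv y) (inv y \<otimes> inv x) \<ge> n - \<delta>"
    using gprod_mult_right[OF iy ix] ixy x y ix iy by (simp add: gprod_commute)
  then have yg: "gprod (inv y) (inv g) \<ge> n - \<delta>"
    using x y by (simp add: g_def inv_mult_group)
  \<comment> \<open>Now \<open>g\<close> starts like \<open>x\<close> and \<open>inv g\<close>
    starts like \<open>inv y\<close>. As \<open>x\<close> and \<open>inv y\<close> diverge at once,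
    so do \<open>g\<close> and \<open>inv g\<close>, although \<open>g\<close> has length about
    \<open>2 * n\<close>: this contradicts \<open>ell\<close>.\<close>
  have "gprod (inv g) x \<le> \<delta> + \<delta>"
    using gprod_le_cancel[of "inv y" "inv g" x \<delta>] x iy g xiy yg n delta_nonneg by simp
  then have "gprod x (inv g) \<le> 2 * \<delta>"
    using x g by (simp add: gprod_commute)
  then have "gprod g (inv g) \<le> 2 * \<delta> + \<delta>"
    using gprod_le_cancel[of x g "inv g" "2 * \<delta>"] x g xg n delta_nonneg by simp
  then have "gprod (inv g) g \<le> 3 * \<delta>"
    using g by (simp add: gprod_commute)
  then show False using ell[OF g] lg n delta_nonneg by (simp add: field_simps)
qed

text \<open>A power of \<open>g\<close> is the value of a constant word, all of whose turns have
  product \<open>M\<close>; so the word is gentle, and the three claims are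
  \<open>gentle_turn\<close>, \<open>gentle_head\<close> and \<open>gentle_norm\<close>.\<close>

lemma loxodromic_powers:
  fixes M :: real
  assumes g: "g \<in> carrier G" and M: "M = gprod (inv g) g" and N: "2 * M + 4 * \<delta> + 1 \<le> l g"
  shows "gprod (inv g) (g [^] (k::nat)) \<le> M + \<delta>"
    and "gprod g (g [^] Suc k) \<ge> l g - M - \<delta>"
    and "l (g [^] k) \<ge> k"
proof -
  have M0: "0 \<le> M" using gprod_nonneg g M by simp
  have val: "word_value G (replicate k g) = g [^] k" for k
  proof (induction k)
    case (Suc k)
    then show ?case using nat_pow_Suc2[OF g, of k] by simp
  qed simp
  have gentle: "gentle M (l g) (replicate k g)" for k
    using g M by (auto simp: gentle_def successively_conv_nth)
  have N': "2 * M + 2 * \<delta> < l g" using N delta_nonneg by linarith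
  show "gprod (inv g) (g [^] k) \<le> M + \<delta>"
    using gentle_turn[of M "l g" g "replicate k g"] gentle[of "Suc k"] M0 N' by (simp add: val)
  show "gprod g (g [^] Suc k) \<ge> l g - M - \<delta>"
    using gentle_head[of M "l g" g "replicate k g"] gentle[of "Suc k"] M0 N' val[of "Suc k"] by simp
  have "real k * 1 \<le> k * (l g - 2 * M - 2 * \<delta>)"
    using N delta_nonneg by (intro mult_left_mono) auto
  then have "real (l (g [^] k)) \<ge> k"
    using gentle_norm[OF gentle M0 N', of k] by (simp add: val)
  then show "l (g [^] k) \<ge> k" by simp
qed

text \<open>By \<open>near\<close>, the point \<open>\<one>\<close> of the orbit of \<open>g\<close>
  is at least as close to \<open>z\<close> as its neighbours \<open>g\<close> and
  \<open>inv g\<close>, so \<open>z\<close> follows each of these for at most half of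
  \<open>l g\<close>. High powers of \<open>g\<close> and of \<open>inv g\<close> start like
  \<open>g\<close> and \<open>inv g\<close>, and together with \<open>z\<close> they form a
  tripod.\<close>

lemma far_from_axis_imp_exponential_growth:
  assumes g: "g \<in> carrier G" and N: "2 * gprod (inv g) g + 4 * \<delta> + 1 \<le> l g"
    and z: "z \<in> carrier G" "real (l z) > l g + 6 * \<delta>"
    and near: "l z \<le> l (g \<otimes> z)" "l z \<le> l (inv g \<otimes> z)"
  shows "\<exists>L. \<forall>m. 2 ^ m \<le> card {v \<in> carrier G. l v \<le> m * L}"
proof -
  define M where "M = gprod (inv g) g"
  \<comment> \<open>The pairwise products will be at most \<open>l g / 2 + \<delta>\<close>, for
    which the tripod lemma asks for lengths above \<open>l g + 6 * \<delta>\<close>. The exponent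
    \<open>Suc k\<close> exceeds this bound.\<close>
  define k where "k = l g + nat \<lceil>6 * \<delta>\<rceil>"
  define p where "p = g [^] Suc k"
  define q where "q = inv g [^] Suc k"
  have ig: "inv g \<in> carrier G" using g by simp
  have M': "M = gprod (inv (inv g)) (inv g)" using g by (simp add: M_def gprod_commute)
  have N': "2 * M + 4 * \<delta> + 1 \<le> l g" "2 * M + 4 * \<delta> + 1 \<le> l (inv g)"
    using N g by (auto simp: M_def)
  have p: "p \<in> carrier G" and q: "q \<in> carrier G" using g by (auto simp: p_def q_def)
  note pw = loxodromic_powers[OF g M_def N'(1)] and pw' = loxodromic_powers[OF ig M' N'(2)]
  have "real (Suc k) > l g + 6 * \<delta>" unfolding k_def by linarith
  then have lpq: "real (l p) > l g + 6 * \<delta>" "real (l q) > l g + 6 * \<delta>"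
    using pw(3)[of "Suc k"] pw'(3)[of "Suc k"] unfolding p_def q_def by linarith+
  have gp: "gprod g p \<ge> l g - M - \<delta>" and gq: "gprod (inv g) q \<ge> l g - M - \<delta>"
    using pw(2)[of k] pw'(2)[of k] g by (auto simp: p_def q_def simp del: nat_pow_Suc)
  have igp: "gprod (inv g) p \<le> M + \<delta>"
    using pw(1)[of "Suc k"] by (simp add: p_def del: nat_pow_Suc)
  have gz: "gprod g z \<le> l g / 2" "gprod (inv g) z \<le> l g / 2"
    using gprod_le_half[OF g z(1)] gprod_le_half[OF ig z(1)] near g by auto
  have pz: "gprod p z \<le> l g / 2 + \<delta>"
    using gp N' by (intro gprod_le_cancel[OF g p z(1) gz(1)]) auto
  have qz: "gprod q z \<le> l g / 2 + \<delta>"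
    using gq N' by (intro gprod_le_cancel[OF ig q z(1) gz(2)]) auto
  have "gprod q p \<le> (M + \<delta>) + \<delta>"
    using gq N' delta_nonneg by (intro gprod_le_cancel[OF ig q p igp]) auto
  then have qp: "gprod q p \<le> l g / 2 + \<delta>" using N' delta_nonneg by simp
  have dist: "p \<noteq> z" "q \<noteq> z" "q \<noteq> p"
  proof -
    show "p \<noteq> z" using pz lpq gprod_self[OF p] delta_nonneg by (intro notI) simp
    show "q \<noteq> z" using qz lpq gprod_self[OF q] delta_nonneg by (intro notI) simp
    show "q \<noteq> p" using qp lpq gprod_self[OF q] delta_nonneg by (intro notI) simp
  qed
  have sym: "gprod z p \<le> l g / 2 + \<delta>" "gprod z q \<le> l g / 2 + \<delta>" "gprod p q \<le> l g / 2 + \<delta>"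
    using pz qz qp gprod_commute[OF p z(1)] gprod_commute[OF q z(1)] gprod_commute[OF q p]
    by simp_all
  show ?thesis
  proof (rule tripod_imp_exponential_growth[where T = "{p, q, z}" and M = "real (l g) / 2 + \<delta>"
        and N = "min (real (l p)) (min (real (l q)) (real (l z)))"])
    show "{p, q, z} \<subseteq> carrier G" "card {p, q, z} = 3" using p q z dist by auto
    fix s t assume "s \<in> {p, q, z}" "t \<in> {p, q, z}" "s \<noteq> t"
    then show "gprod s t \<le> l g / 2 + \<delta>"
      using pz qz qp sym by (elim insertE emptyE) simp_all
  next
    fix s assume "s \<in> {p, q, z}"
    then show "min (real (l p)) (min (real (l q)) (real (l z))) \<le> l s"
      by (elim insertE emptyE) simp_all
  qed (use lpq z delta_nonneg in auto)
qed

text \<open>Take a loxodromic \<open>g\<close>. Without exponential growth, a shortest element of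
  any right coset of the cyclic group of \<open>g\<close> cannot be far from the axis, so it lies in
  a fixed ball. Balls are finite, so this subgroup would have finite index.\<close>

lemma non_elementary_imp_exponential_growth:
  assumes "non_elementary G"
  shows "\<exists>L. \<forall>m. 2 ^ m \<le> card {v \<in> carrier G. l v \<le> m * L}"
proof -
  have inf: "infinite (carrier G)" and vc: "\<And>g. g \<in> carrier G \<Longrightarrow> infinite (rcosets (generate G {g}))"
    using assms by (auto simp: non_elementary_def)
  obtain g where g: "g \<in> carrier G" "2 * gprod (inv g) g + (4 * \<delta> + 1) \<le> l g"
    using exists_loxodromic[OF inf] by blast
  define A where "A = generate G {g}"
  interpret A: subgroup A G unfolding A_def using g by (intro generate_is_subgroup) auto
  have gA: "g \<in> A" "inv g \<in> A" by (auto simp: A_def intro: generate.intros)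
  show ?thesis
  proof (rule ccontr)
    assume neg: "\<not> ?thesis"
    have near: "\<exists>u\<in>carrier G. A #> z = A #> u \<and> l u \<le> l g + nat \<lceil>6 * \<delta>\<rceil>"
      if z: "z \<in> carrier G" for z
    proof -
      obtain w where w: "w \<in> A" and wmin: "\<And>v. v \<in> A \<Longrightarrow> l (w \<otimes> z) \<le> l (v \<otimes> z)"
        using ex_has_least_nat[of "\<lambda>w. w \<in> A" \<one> "\<lambda>w. l (w \<otimes> z)"] by auto
      define u where "u = w \<otimes> z"
      have u: "u \<in> carrier G" using w z by (simp add: u_def)
      \<comment> \<open>Minimality in the whole coset; only the instances \<open>g\<close> and
        \<open>inv g\<close> enter, as the condition \<open>near\<close> of the previous
        lemma.\<close>
      have umin: "l u \<le> l (v \<otimes> u)" if "v \<in> A" for v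
        using wmin[of "v \<otimes> w"] w z that by (simp add: u_def m_assoc)
      have "A #> u = A #> z"
        using w z A.subset A.rcos_const[of w] coset_mult_assoc[of A w z] by (simp add: u_def is_group)
      moreover have "\<not> real (l u) > l g + 6 * \<delta>"
        using far_from_axis_imp_exponential_growth[of g u] neg g u umin gA by fastforce
      then have "l u \<le> l g + nat \<lceil>6 * \<delta>\<rceil>" by linarith
      ultimately show ?thesis using u by auto
    qed
    have "rcosets A \<subseteq> (\<lambda>u. A #> u) ` {u \<in> carrier G. l u \<le> l g + nat \<lceil>6 * \<delta>\<rceil>}"
      using near by (fastforce simp: RCOSETS_def)
    then have "finite (rcosets A)"
      using finite_ball finite_surj by blast
    then show False using vc[OF g(1)] by (simp add: A_def)
  qed
qed

end

section \<open>Geodesics for a second generating set\<close>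

context word_norm
begin

definition ndist :: "'a \<Rightarrow> 'a \<Rightarrow> nat" where
  "ndist x y = l (inv x \<otimes> y)"

lemma ndist_refl [simp]: "x \<in> carrier G \<Longrightarrow> ndist x x = 0"
  by (simp add: ndist_def)

lemma ndist_one [simp]: "x \<in> carrier G \<Longrightarrow> ndist \<one> x = l x"
  by (simp add: ndist_def)

lemma ndist_commute: "\<lbrakk>x \<in> carrier G; y \<in> carrier G\<rbrakk> \<Longrightarrow> ndist x y = ndist y x"
  by (simp add: ndist_def norm_inv_mult_commute)

lemma inv_mult_cancel_left:
  "\<lbrakk>w \<in> carrier G; x \<in> carrier G; y \<in> carrier G\<rbrakk>
    \<Longrightarrow> inv (w \<otimes> x) \<otimes> (w \<otimes> y) = inv x \<otimes> y"
  by (metis inv_closed inv_mult_group inv_solve_left' m_assoc m_closed)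

lemma ndist_mult_left:
  "\<lbrakk>w \<in> carrier G; x \<in> carrier G; y \<in> carrier G\<rbrakk> \<Longrightarrow> ndist (w \<otimes> x) (w \<otimes> y) = ndist x y"
  by (simp add: ndist_def inv_mult_cancel_left)

lemma ndist_triangle:
  assumes "x \<in> carrier G" "y \<in> carrier G" "z \<in> carrier G"
  shows "ndist x z \<le> ndist x y + ndist y z"
proof -
  have "(inv x \<otimes> y) \<otimes> (inv y \<otimes> z) = inv x \<otimes> z"
    using assms by (metis inv_closed inv_solve_left m_assoc m_closed)
  then show ?thesis
    using norm_mult[of "inv x \<otimes> y" "inv y \<otimes> z"] assms by (simp add: ndist_def)
qed

lemma gprod_ndist:
  "\<lbrakk>x \<in> carrier G; y \<in> carrier G\<rbrakk> \<Longrightarrow> gprod x y = (real (l x) + real (l y) - real (ndist x y)) / 2"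
  by (simp add: gprod_def ndist_def)

lemma gprod_translate:
  "\<lbrakk>w \<in> carrier G; x \<in> carrier G; y \<in> carrier G\<rbrakk>
    \<Longrightarrow> gprod (inv w \<otimes> x) (inv w \<otimes> y) = (real (ndist w x) + real (ndist w y) - real (ndist x y)) / 2"
  by (simp add: gprod_def ndist_def inv_mult_cancel_left)

text \<open>Steps may be shorter than 1. A geodesic is a path with exactly \<open>ndist x y\<close>
  steps and gets no definition of its own.\<close>

definition path_on :: "(nat \<Rightarrow> 'a) \<Rightarrow> nat \<Rightarrow> 'a \<Rightarrow> 'a \<Rightarrow> bool" where
  "path_on f n x y \<longleftrightarrow> f 0 = x \<and> f n = y \<and> (\<forall>i\<le>n. f i \<in> carrier G) \<and>
     (\<forall>i<n. ndist (f i) (f (Suc i)) \<le> 1)"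

lemma path_closed: "path_on f n x y \<Longrightarrow> i \<le> n \<Longrightarrow> f i \<in> carrier G"
  by (simp add: path_on_def)

lemma path_ndist_le:
  assumes f: "path_on f n x y" and "i \<le> j" "j \<le> n"
  shows "ndist (f i) (f j) \<le> j - i"
  using assms(2,3)
proof (induction j rule: dec_induct)
  case base
  then show ?case using path_closed[OF f, of i] by simp
next
  case (step j)
  have "ndist (f i) (f (Suc j)) \<le> ndist (f i) (f j) + ndist (f j) (f (Suc j))"
    using step path_closed[OF f] by (intro ndist_triangle) auto
  also have "\<dots> \<le> (j - i) + 1"
    using step f by (intro add_mono) (auto simp: path_on_def)
  finally show ?case using step by simp
qed

text \<open>The three subpaths cut out by \<open>i\<close> and \<open>j\<close> are at most as long
  as their numbers of steps, and these add up to the full distance. By the triangle inequality none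
  can be shorter.\<close>

lemma geodesic_ndist:
  assumes f: "path_on f (ndist x y) x y" and "i \<le> j" "j \<le> ndist x y"
  shows "ndist (f i) (f j) = j - i"
proof -
  let ?n = "ndist x y"
  have c: "f 0 \<in> carrier G" "f i \<in> carrier G" "f j \<in> carrier G" "f ?n \<in> carrier G"
    using path_closed[OF f] assms by auto
  have "ndist (f 0) (f ?n) \<le> ndist (f 0) (f i) + (ndist (f i) (f j) + ndist (f j) (f ?n))"
    using ndist_triangle[OF c(1,2,4)] ndist_triangle[OF c(2,3,4)] by linarith
  moreover have "ndist (f 0) (f ?n) = ?n" using f by (simp add: path_on_def)
  moreover have "ndist (f 0) (f i) \<le> i - 0" "ndist (f i) (f j) \<le> j - i" "ndist (f j) (f ?n) \<le> ?n - j"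
    using assms by (intro path_ndist_le[OF f]; simp)+
  ultimately show ?thesis using assms by linarith
qed

lemma path_translate:
  assumes "path_on f n x y" "w \<in> carrier G"
  shows "path_on (\<lambda>i. w \<otimes> f i) n (w \<otimes> x) (w \<otimes> y)"
  using assms by (auto simp: path_on_def ndist_mult_left)

lemma path_snoc:
  assumes "path_on f n x y" "z \<in> carrier G" "ndist y z \<le> 1"
  shows "path_on (f(Suc n := z)) (Suc n) x z"
  using assms by (auto simp: path_on_def less_Suc_eq)

lemma path_from_one_exists:
  "x \<in> carrier G \<Longrightarrow> l x = n \<Longrightarrow> \<exists>f. path_on f n \<one> x"
proof (induction n arbitrary: x)
  case 0
  then show ?case
    using norm_zero[of x] by (intro exI[of _ "\<lambda>i. \<one>"]) (auto simp: path_on_def)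
next
  case (Suc n)
  then obtain y z where yz: "y \<in> carrier G" "z \<in> carrier G" "x = y \<otimes> z" "l y = n" "l z = 1"
    using norm_split[of x n 1] by auto
  then obtain f where "path_on f n \<one> y" using Suc.IH by blast
  moreover have "ndist y x = 1"
    using yz by (simp add: ndist_def flip: m_assoc)
  ultimately show ?case using path_snoc Suc.prems(1) by (metis order_refl)
qed

lemma geodesic_exists:
  assumes "x \<in> carrier G" "y \<in> carrier G"
  shows "\<exists>f. path_on f (ndist x y) x y"
proof -
  obtain f where "path_on f (ndist x y) \<one> (inv x \<otimes> y)"
    using path_from_one_exists[of "inv x \<otimes> y"] assms by (auto simp: ndist_def)
  from path_translate[OF this assms(1)] show ?thesis
    using assms by (auto simp flip: m_assoc)
qed

lemma path_append:
  assumes f: "path_on f n x y" and g: "path_on g m y z"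
  shows "path_on (\<lambda>i. if i \<le> n then f i else g (i - n)) (n + m) x z"
proof -
  have "ndist (if i \<le> n then f i else g (i - n)) (if Suc i \<le> n then f (Suc i) else g (Suc i - n)) \<le> 1"
    if "i < n + m" for i
  proof -
    consider "i < n" | "i = n" | "i > n" by linarith
    then show ?thesis
    proof cases
      case 1
      then show ?thesis using f by (simp add: path_on_def)
    next
      case 2
      then show ?thesis using f g that by (auto simp: path_on_def)
    next
      case 3
      then have "Suc i - n = Suc (i - n)" "i - n < m" using that by auto
      then show ?thesis using g 3 by (simp add: path_on_def)
    qed
  qed
  then show ?thesis using f g by (auto simp: path_on_def)
qed

end

section \<open>Geodesics in a hyperbolic metric stay near paths\<close>

context hyperbolic_norm
begin

text \<open>Halving the path costs one \<open>\<delta>\<close> at each of the \<open>k\<close> stages.\<close>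

lemma gprod_path_greater:
  assumes "a < b" "b - a \<le> 2 ^ k" "\<And>i. \<lbrakk>a \<le> i; i \<le> b\<rbrakk> \<Longrightarrow> f i \<in> carrier G"
    and "\<And>i. \<lbrakk>a \<le> i; i < b\<rbrakk> \<Longrightarrow> c < gprod (f i) (f (Suc i))"
  shows "c - k * \<delta> < gprod (f a) (f b)"
  using assms
proof (induction k arbitrary: a b)
  case 0
  then have "b = Suc a" by simp
  then show ?case using 0 by simp
next
  case (Suc k)
  show ?case
  proof (cases "b - a \<le> 2 ^ k")
    case True
    then have "c - k * \<delta> < gprod (f a) (f b)"
      using Suc by blast
    then show ?thesis using delta_nonneg by (simp add: algebra_simps)
  next
    case False
    define e where "e = a + 2 ^ k"
    have e: "a < e" "e < b" "e - a \<le> 2 ^ k" "b - e \<le> 2 ^ k"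
      using False Suc.prems by (auto simp: e_def)
    have "c - k * \<delta> < gprod (f a) (f e)"
      using e Suc.prems by (intro Suc.IH) auto
    moreover have "c - k * \<delta> < gprod (f e) (f b)"
      using e Suc.prems by (intro Suc.IH) auto
    moreover have "gprod (f a) (f b) \<ge> min (gprod (f a) (f e)) (gprod (f e) (f b)) - \<delta>"
      using e Suc.prems by (intro gprod_ge_min) auto
    ultimately show ?thesis by (simp add: algebra_simps)
  qed
qed

text \<open>By \<open>on\<close>, the end points have Gromov product 0 as seen from
  \<open>w\<close>. If all consecutive points had products above \<open>k * \<delta>\<close>,
  bisection would make that product positive. So some step has a small product, and its starting
  point is within \<open>C\<close> more of \<open>w\<close>.\<close>

lemma path_near_geodesic_point:
  fixes C :: real
  assumes w: "w \<in> carrier G" and f: "\<And>i. i \<le> m \<Longrightarrow> f i \<in> carrier G"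
    and step: "\<And>i. i < m \<Longrightarrow> ndist (f i) (f (Suc i)) \<le> C" and "0 \<le> C"
    and on: "ndist w (f 0) + ndist w (f m) = ndist (f 0) (f m)" and m: "m \<le> 2 ^ k"
  shows "\<exists>i\<le>m. ndist w (f i) \<le> k * \<delta> + C"
proof (cases "m = 0")
  case True
  then have "ndist w (f 0) = 0" using on f by simp
  then show ?thesis using True delta_nonneg \<open>0 \<le> C\<close> by simp
next
  case False
  have "\<exists>i<m. gprod (inv w \<otimes> f i) (inv w \<otimes> f (Suc i)) \<le> k * \<delta>"
  proof (rule ccontr)
    assume "\<not> ?thesis"
    then have "k * \<delta> - k * \<delta> < gprod (inv w \<otimes> f 0) (inv w \<otimes> f m)"
      using False m w f by (intro gprod_path_greater) (auto simp: not_le)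
    moreover have "gprod (inv w \<otimes> f 0) (inv w \<otimes> f m) = 0"
      using on w f[of 0] f[of m] by (simp add: gprod_translate flip: on)
    ultimately show False by simp
  qed
  then obtain i where i: "i < m" "gprod (inv w \<otimes> f i) (inv w \<otimes> f (Suc i)) \<le> k * \<delta>" by blast
  have fi: "f i \<in> carrier G" "f (Suc i) \<in> carrier G" using f i by auto
  have "ndist w (f i) \<le> ndist w (f (Suc i)) + ndist (f i) (f (Suc i))"
    using ndist_triangle[OF w fi(2,1)] ndist_commute fi by simp
  then have "real (ndist w (f i)) \<le> real (ndist w (f (Suc i))) + real (ndist (f i) (f (Suc i)))"
    by linarith
  then have "ndist w (f i) \<le> k * \<delta> + C"
    using i step[OF i(1)] gprod_translate[OF w fi] by simp
  then show ?thesis using i by (intro exI[of _ i]) simp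
qed

end

text \<open>Growth and distances are measured with \<open>l\<close>, while the four-point condition
  is assumed for \<open>l0\<close>.\<close>

locale bilipschitz_hyperbolic_norm = word_norm G l + hyp: hyperbolic_norm G l0 \<delta>
  for G (structure) and l l0 \<delta> +
  fixes C :: real
  assumes C_ge_1: "1 \<le> C"
    and norm_le: "x \<in> carrier G \<Longrightarrow> l x \<le> C * l0 x"
    and norm_ge: "x \<in> carrier G \<Longrightarrow> l0 x \<le> C * l x"
begin

lemma ndist_le: "\<lbrakk>x \<in> carrier G; y \<in> carrier G\<rbrakk> \<Longrightarrow> ndist x y \<le> C * hyp.ndist x y"
  using norm_le by (simp add: ndist_def hyp.ndist_def)

lemma ndist_ge: "\<lbrakk>x \<in> carrier G; y \<in> carrier G\<rbrakk> \<Longrightarrow> hyp.ndist x y \<le> C * ndist x y"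
  using norm_ge by (simp add: ndist_def hyp.ndist_def)

text \<open>The distance in \<open>path_near_geodesic_point\<close> for a path of \<open>l\<close>,
  whose steps have \<open>l0\<close>-length at most \<open>C\<close>.\<close>

definition rad :: "nat \<Rightarrow> real" where
  "rad k = k * \<delta> + C"

lemma rad_nonneg: "0 \<le> rad k"
  using C_ge_1 hyp.delta_nonneg by (simp add: rad_def)

text \<open>The easy half of the Morse lemma: an \<open>l0\<close>-geodesic stays near any
  \<open>l\<close>-path with the same ends, because such a path has bounded
  \<open>l0\<close>-steps.\<close>

lemma path_near_hyp_geodesic:
  assumes f: "path_on f m x y" and m: "m \<le> 2 ^ k"
    and g: "hyp.path_on g (hyp.ndist x y) x y" and v: "v \<le> hyp.ndist x y"
  shows "\<exists>i\<le>m. hyp.ndist (g v) (f i) \<le> rad k"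
  unfolding rad_def
proof (rule hyp.path_near_geodesic_point[OF _ _ _ _ _ m])
  show gv: "g v \<in> carrier G" using hyp.path_closed[OF g v] .
  show "f i \<in> carrier G" if "i \<le> m" for i using path_closed[OF f that] .
  show "hyp.ndist (f i) (f (Suc i)) \<le> C" if "i < m" for i
  proof -
    have "f i \<in> carrier G" "f (Suc i) \<in> carrier G" "ndist (f i) (f (Suc i)) \<le> 1"
      using f that by (auto simp: path_on_def)
    then have "hyp.ndist (f i) (f (Suc i)) \<le> C * real (ndist (f i) (f (Suc i)))"
      by (intro ndist_ge)
    also have "\<dots> \<le> C * 1"
      using C_ge_1 \<open>ndist (f i) (f (Suc i)) \<le> 1\<close> by (intro mult_left_mono) auto
    finally show ?thesis by simp
  qed
  show "0 \<le> C" using C_ge_1 by simp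
  have fx: "f 0 = x" "f m = y" "g 0 = x" "g (hyp.ndist x y) = y"
    using f g by (auto simp: path_on_def hyp.path_on_def)
  have x: "x \<in> carrier G" using path_closed[OF f, of 0] fx by simp
  have "hyp.ndist (g v) x = v"
    using hyp.geodesic_ndist[OF g, of 0 v] v fx hyp.ndist_commute[OF gv x] by simp
  moreover have "hyp.ndist (g v) y = hyp.ndist x y - v"
    using hyp.geodesic_ndist[OF g, of v "hyp.ndist x y"] v fx by simp
  ultimately show "hyp.ndist (g v) (f 0) + hyp.ndist (g v) (f m) = hyp.ndist (f 0) (f m)"
    using v fx by simp
qed

text \<open>Weak Morse lemma, with a radius growing logarithmically in the length: as \<open>g v\<close> runs along
  the \<open>l0\<close>-geodesic, the nearby points of the \<open>l\<close>-geodesic jump over \<open>f s\<close> at some time, and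
  the jump is short.\<close>

lemma geodesic_near_hyp_geodesic:
  assumes f: "path_on f (ndist x y) x y" and n: "ndist x y \<le> 2 ^ k" and s: "s \<le> ndist x y"
    and g: "hyp.path_on g (hyp.ndist x y) x y"
  shows "\<exists>v\<le>hyp.ndist x y. hyp.ndist (f s) (g v) \<le> rad k + C * (C * (2 * rad k + 1))"
proof -
  let ?n = "ndist x y" and ?m = "hyp.ndist x y"
  have fx: "f 0 = x" "f ?n = y" "g 0 = x" "g ?m = y"
    using f g by (auto simp: path_on_def hyp.path_on_def)
  have fc: "f i \<in> carrier G" if "i \<le> ?n" for i using path_closed[OF f that] .
  have gc: "g i \<in> carrier G" if "i \<le> ?m" for i using hyp.path_closed[OF g that] .
  \<comment> \<open>The times at which the \<open>l0\<close>-geodesic is near the part of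
    \<open>f\<close> up to \<open>s\<close>. After the last of them it is near the part from
    \<open>s\<close> on; this change is the jump over \<open>f s\<close>.\<close>
  define A where "A = {v. v \<le> ?m \<and> (\<exists>i\<le>s. hyp.ndist (g v) (f i) \<le> rad k)}"
  have "0 \<in> A"
    using fx fc[of 0] rad_nonneg by (auto simp: A_def intro!: exI[of _ 0])
  moreover have finA: "finite A" by (simp add: A_def)
  ultimately have "Max A \<in> A" by (intro Max_in) auto
  define v where "v = Max A"
  have v: "v \<le> ?m" using \<open>Max A \<in> A\<close> by (simp add: A_def v_def)
  obtain i where i: "i \<le> s" "hyp.ndist (g v) (f i) \<le> rad k"
    using \<open>Max A \<in> A\<close> by (auto simp: A_def v_def)
  \<comment> \<open>The extra 1 pays for going back from \<open>g (Suc v)\<close> to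
    \<open>g v\<close>.\<close>
  have "\<exists>j. s \<le> j \<and> j \<le> ?n \<and> hyp.ndist (g v) (f j) \<le> rad k + 1"
  proof (cases "v = ?m")
    case True
    then show ?thesis using s fx fc[of ?n] rad_nonneg[of k] by (intro exI[of _ ?n]) auto
  next
    case False
    then have v': "Suc v \<le> ?m" using v by simp
    have "Suc v \<notin> A" using Max_ge[OF finA, of "Suc v"] by (auto simp: v_def)
    moreover obtain j where j: "j \<le> ?n" "hyp.ndist (g (Suc v)) (f j) \<le> rad k"
      using path_near_hyp_geodesic[OF f n g v'] by blast
    ultimately have "s \<le> j" using v' nle_le by (auto simp: A_def)
    have "hyp.ndist (g v) (f j) \<le> hyp.ndist (g v) (g (Suc v)) + hyp.ndist (g (Suc v)) (f j)"
      using gc fc v v' j by (intro hyp.ndist_triangle) auto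
    moreover have "hyp.ndist (g v) (g (Suc v)) \<le> 1"
      using g v' by (auto simp: hyp.path_on_def)
    ultimately have "hyp.ndist (g v) (f j) \<le> rad k + 1"
      using j by linarith
    then show ?thesis using \<open>s \<le> j\<close> j by blast
  qed
  then obtain j where j: "s \<le> j" "j \<le> ?n" "hyp.ndist (g v) (f j) \<le> rad k + 1" by blast
  have c: "f i \<in> carrier G" "f s \<in> carrier G" "f j \<in> carrier G" "g v \<in> carrier G"
    using fc gc i s j v by auto
  \<comment> \<open>Both \<open>f i\<close> and \<open>f j\<close> are near \<open>g v\<close>, so
    they are close to each other. As \<open>f\<close> is an \<open>l\<close>-geodesic,
    \<open>j - i\<close> is their distance, and \<open>s\<close> lies between \<open>i\<close> and
    \<open>j\<close>.\<close>
  have "real (s - i) \<le> real (j - i)" using i j by simp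
  also have "\<dots> = ndist (f i) (f j)" using geodesic_ndist[OF f] i j by simp
  also have "\<dots> \<le> C * hyp.ndist (f i) (f j)" by (rule ndist_le[OF c(1,3)])
  also have "\<dots> \<le> C * (2 * rad k + 1)"
  proof (rule mult_left_mono)
    have "hyp.ndist (f i) (f j) \<le> hyp.ndist (g v) (f i) + hyp.ndist (g v) (f j)"
      using hyp.ndist_triangle[OF c(1,4,3)] hyp.ndist_commute[OF c(1,4)] by simp
    then show "real (hyp.ndist (f i) (f j)) \<le> 2 * rad k + 1" using i j by linarith
  qed (use C_ge_1 in simp)
  finally have si: "real (s - i) \<le> C * (2 * rad k + 1)" .
  have "hyp.ndist (f s) (f i) \<le> C * ndist (f s) (f i)" by (rule ndist_ge[OF c(2,1)])
  also have "ndist (f s) (f i) = s - i"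
    using geodesic_ndist[OF f i(1) s] ndist_commute[OF c(1,2)] by simp
  also have "C * real (s - i) \<le> C * (C * (2 * rad k + 1))"
    using si C_ge_1 by (intro mult_left_mono) auto
  finally have "hyp.ndist (f s) (f i) \<le> C * (C * (2 * rad k + 1))" .
  moreover have "hyp.ndist (f s) (g v) \<le> hyp.ndist (f s) (f i) + hyp.ndist (g v) (f i)"
    using hyp.ndist_triangle[OF c(2,1,4)] hyp.ndist_commute[OF c(1,4)] by simp
  ultimately have "hyp.ndist (f s) (g v) \<le> rad k + C * (C * (2 * rad k + 1))"
    using i by linarith
  then show ?thesis using v by blast
qed

text \<open>The distance from an \<open>l\<close>-geodesic to an \<open>l0\<close>-geodesic plus
  that from the latter to a path, converted to \<open>l\<close> by the factor \<open>C\<close>. The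
  final 1 leaves room for one step along a geodesic.\<close>

definition thinness :: "nat \<Rightarrow> real" where
  "thinness k = C * (2 * rad k + C * (C * (2 * rad k + 1))) + 1"

lemma geodesic_near_path:
  assumes f: "path_on f (ndist x y) x y" and n: "ndist x y \<le> 2 ^ k" and s: "s \<le> ndist x y"
    and q: "path_on q m x y" and m: "m \<le> 2 ^ k"
  shows "\<exists>i\<le>m. ndist (f s) (q i) \<le> thinness k - 1"
proof -
  have xy: "x \<in> carrier G" "y \<in> carrier G"
    using path_closed[OF q, of 0] path_closed[OF q, of m] q by (auto simp: path_on_def)
  obtain g where g: "hyp.path_on g (hyp.ndist x y) x y"
    using hyp.geodesic_exists[OF xy] by blast
  obtain v where v: "v \<le> hyp.ndist x y" "hyp.ndist (f s) (g v) \<le> rad k + C * (C * (2 * rad k + 1))"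
    using geodesic_near_hyp_geodesic[OF f n s g] by blast
  obtain i where i: "i \<le> m" "hyp.ndist (g v) (q i) \<le> rad k"
    using path_near_hyp_geodesic[OF q m g v(1)] by blast
  have c: "f s \<in> carrier G" "g v \<in> carrier G" "q i \<in> carrier G"
    using path_closed[OF f s] hyp.path_closed[OF g v(1)] path_closed[OF q i(1)] by auto
  have "ndist (f s) (q i) \<le> C * hyp.ndist (f s) (q i)" by (rule ndist_le[OF c(1,3)])
  also have "\<dots> \<le> C * (2 * rad k + C * (C * (2 * rad k + 1)))"
    using hyp.ndist_triangle[OF c] v i C_ge_1 by (intro mult_left_mono) linarith+
  finally show ?thesis using i by (auto simp: thinness_def)
qed

text \<open>A thin triangle with corners \<open>\<one>\<close>, \<open>h\<close>, \<open>h'\<close>: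
  each point of \<open>f\<close> is near one of the other two sides, since these form a path from
  \<open>\<one>\<close> to \<open>h\<close>. The last point of \<open>f\<close> near
  \<open>g\<close> is, up to one step, near the third side too, so it marks where the geodesics
  part, at about \<open>gprod h h'\<close>.\<close>

lemma geodesics_fellow_travel:
  assumes h: "h \<in> carrier G" "h' \<in> carrier G"
    and f: "path_on f (l h) \<one> h" and g: "path_on g (l h') \<one> h'"
    and k: "l h \<le> 2 ^ k" "l h' + ndist h h' \<le> 2 ^ k"
  shows "\<exists>s\<le>l h. \<exists>u\<le>l h'. ndist (f s) (g u) \<le> thinness k \<and> gprod h h' \<le> u + 2 * thinness k"
proof -
  define R where "R = thinness k"
  have R: "1 \<le> R" using rad_nonneg[of k] C_ge_1 by (simp add: R_def thinness_def)
  have f': "path_on f (ndist \<one> h) \<one> h" and g': "path_on g (ndist \<one> h') \<one> h'"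
    using f g h by simp_all
  obtain p where p: "path_on p (ndist h' h) h' h" using geodesic_exists h by blast
  note ends = f[unfolded path_on_def] g[unfolded path_on_def] p[unfolded path_on_def]
  have fc: "f i \<in> carrier G" if "i \<le> l h" for i using path_closed[OF f that] .
  have gc: "g i \<in> carrier G" if "i \<le> l h'" for i using path_closed[OF g that] .
  have pc: "p i \<in> carrier G" if "i \<le> ndist h' h" for i using path_closed[OF p that] .
  have near: "(\<exists>u\<le>l h'. ndist (f s) (g u) \<le> R - 1) \<or> (\<exists>v\<le>ndist h' h. ndist (f s) (p v) \<le> R - 1)"
    if "s \<le> l h" for s
  proof -
    have "\<exists>i\<le>l h' + ndist h' h. ndist (f s) (if i \<le> l h' then g i else p (i - l h')) \<le> R - 1"
      unfolding R_def
      by (rule geodesic_near_path[OF f' _ _ path_append[OF g p]])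
        (use h k that ndist_commute[OF h] in auto)
    then obtain i where i: "i \<le> l h' + ndist h' h"
      "ndist (f s) (if i \<le> l h' then g i else p (i - l h')) \<le> R - 1" by blast
    show ?thesis
    proof (cases "i \<le> l h'")
      case False
      then have "i - l h' \<le> ndist h' h" using i by linarith
      then show ?thesis using i False by auto
    qed (use i in auto)
  qed
  define A where "A = {s. s \<le> l h \<and> (\<exists>u\<le>l h'. ndist (f s) (g u) \<le> R - 1)}"
  have "0 \<in> A" using ends R by (auto simp: A_def intro!: exI[of _ 0])
  moreover have finA: "finite A" by (simp add: A_def)
  ultimately have "Max A \<in> A" by (intro Max_in) auto
  define s where "s = Max A"
  obtain u where s: "s \<le> l h" and u: "u \<le> l h'" "ndist (f s) (g u) \<le> R - 1"
    using \<open>Max A \<in> A\<close> by (auto simp: A_def s_def)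
  have "\<exists>v\<le>ndist h' h. ndist (f s) (p v) \<le> R"
  proof (cases "s = l h")
    case True
    then show ?thesis using ends R h by (intro exI[of _ "ndist h' h"]) auto
  next
    case False
    then have s': "Suc s \<le> l h" using s by simp
    have "Suc s \<notin> A" using Max_ge[OF finA, of "Suc s"] by (auto simp: s_def)
    then obtain v where v: "v \<le> ndist h' h" "ndist (f (Suc s)) (p v) \<le> R - 1"
      using near[OF s'] s' by (auto simp: A_def)
    have "ndist (f s) (p v) \<le> ndist (f s) (f (Suc s)) + ndist (f (Suc s)) (p v)"
      using fc pc s s' v by (intro ndist_triangle) auto
    moreover have "ndist (f s) (f (Suc s)) \<le> 1" using ends(1) s' by auto
    ultimately show ?thesis using v by (intro exI[of _ v]) linarith
  qed
  then obtain v where v: "v \<le> ndist h' h" "ndist (f s) (p v) \<le> R" by blast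
  have c: "f s \<in> carrier G" "g u \<in> carrier G" "p v \<in> carrier G"
    using fc[OF s] gc[OF u(1)] pc[OF v(1)] .
  have l1: "l (f s) = s" "l (g u) = u"
    using geodesic_ndist[OF f', of 0 s] geodesic_ndist[OF g', of 0 u] ends c s u h by auto
  have hfs: "ndist h (f s) = l h - s"
    using geodesic_ndist[OF f', of s "l h"] ends c s h ndist_commute[OF c(1) h(1)] by auto
  have hgu: "ndist h' (g u) = l h' - u"
    using geodesic_ndist[OF g', of u "l h'"] ends c u h ndist_commute[OF c(2) h(2)] by auto
  have hp: "ndist h (p v) = ndist h' h - v" "ndist h' (p v) = v"
    using geodesic_ndist[OF p, of v "ndist h' h"] geodesic_ndist[OF p, of 0 v]
      ends v ndist_commute[OF c(3) h(1)] by auto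
  have "ndist h (f s) \<le> ndist h (p v) + ndist (f s) (p v)"
    using ndist_triangle[OF h(1) c(3,1)] ndist_commute[OF c(1,3)] by simp
  then have e1: "real (l h) - s \<le> real (ndist h h') - v + R"
    using hfs hp v s ndist_commute[OF h] by linarith
  have "ndist h' (g u) \<le> ndist h' (p v) + (ndist (f s) (p v) + ndist (f s) (g u))"
    using ndist_triangle[OF h(2) c(3,2)] ndist_triangle[OF c(3,1,2)] ndist_commute[OF c(1,3)] by simp
  then have e2: "real (l h') - u \<le> v + R + R"
    using hgu hp u v by linarith
  have "s \<le> u + ndist (f s) (g u)"
    using ndist_triangle[OF one_closed c(2,1)] ndist_commute[OF c(1,2)] l1 c by simp
  then have e3: "real s \<le> u + R" using u by linarith
  \<comment> \<open>Adding \<open>e1\<close> and \<open>e2\<close> cancels the position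
    \<open>v\<close> on the third side, and \<open>e3\<close> replaces \<open>s\<close> by
    \<open>u\<close>.\<close>
  have "gprod h h' \<le> u + 2 * R"
    using e1 e2 e3 R by (simp add: gprod_ndist[OF h])
  then show ?thesis
    using s u by (intro exI[of _ s] conjI exI[of _ u]) (auto simp: R_def)
qed

text \<open>Fix one geodesic to \<open>h\<close>. Each counted \<open>h'\<close> is determined by
  the index at which its own geodesic leaves this one, a bridge of length at most
  \<open>thinness k\<close>, and the rest of its geodesic. That rest has length
  \<open>b - u\<close>, where \<open>u\<close> is at least \<open>t\<close> up to twice the
  thinness.\<close>

lemma card_large_gprod_le:
  assumes h: "h \<in> carrier G" "l h \<le> n" and b: "b \<le> n" and k: "3 * n \<le> 2 ^ k"
  shows "card {h' \<in> carrier G. l h' = b \<and> t \<le> gprod h h'} \<le>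
    (n + 1) * (card {x \<in> carrier G. real (l x) \<le> thinness k} *
      card {x \<in> carrier G. real (l x) \<le> b - t + 2 * thinness k})"
proof -
  define R where "R = thinness k"
  obtain f where f: "path_on f (l h) \<one> h" using path_from_one_exists h by blast
  have fin: "finite {x \<in> carrier G. real (l x) \<le> q}" for q
    by (rule finite_subset[OF _ finite_ball[of "nat \<lfloor>q\<rfloor>"]]) (auto simp: le_nat_floor)
  let ?X = "{..n} \<times> ({x \<in> carrier G. real (l x) \<le> R} \<times> {x \<in> carrier G. real (l x) \<le> b - t + 2 * R})"
  let ?F = "\<lambda>(s, x, r). f s \<otimes> x \<otimes> r"
  have "{h' \<in> carrier G. l h' = b \<and> t \<le> gprod h h'} \<subseteq> ?F ` ?X"
  proof safe
    fix h' assume h': "h' \<in> carrier G" "t \<le> gprod h h'" "b = l h'"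
    obtain g where g: "path_on g (l h') \<one> h'" using path_from_one_exists h' by blast
    have "ndist h h' \<le> l h + l h'"
      using norm_mult[of "inv h" h'] h h' by (simp add: ndist_def)
    \<comment> \<open>The path from \<open>\<one>\<close> through \<open>h'\<close> to
      \<open>h\<close> has at most \<open>3 * n\<close> steps, whence the assumption on
      \<open>k\<close>.\<close>
    then obtain s u where su: "s \<le> l h" "u \<le> l h'" "ndist (f s) (g u) \<le> R" "gprod h h' \<le> u + 2 * R"
      using geodesics_fellow_travel[OF h(1) h'(1) f g, of k] h h' b k by (auto simp: R_def)
    have c: "f s \<in> carrier G" "g u \<in> carrier G"
      using path_closed[OF f su(1)] path_closed[OF g su(2)] .
    have "ndist (g u) h' = l h' - u"
      using geodesic_ndist[of g \<one> h' u "l h'"] g h' su by (simp add: path_on_def)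
    then have "real (l (inv (g u) \<otimes> h')) \<le> l h' - t + 2 * R"
      using su h' by (simp add: ndist_def)
    moreover have "h' = f s \<otimes> (inv (f s) \<otimes> g u) \<otimes> (inv (g u) \<otimes> h')"
      using c h' by (metis inv_closed inv_solve_left m_assoc m_closed)
    moreover have "real (l (inv (f s) \<otimes> g u)) \<le> R" using su by (simp add: ndist_def)
    ultimately show "h' \<in> ?F ` ({..n} \<times> ({x \<in> carrier G. real (l x) \<le> R} \<times>
        {x \<in> carrier G. real (l x) \<le> l h' - t + 2 * R}))"
      using c h' su h by (intro image_eqI[of _ _ "(s, inv (f s) \<otimes> g u, inv (g u) \<otimes> h')"]) auto
  qed
  then have "card {h' \<in> carrier G. l h' = b \<and> t \<le> gprod h h'} \<le> card (?F ` ?X)"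
    using fin by (intro card_mono finite_imageI finite_cartesian_product) auto
  also have "\<dots> \<le> card ?X"
    using fin by (intro card_image_le finite_cartesian_product) auto
  finally show ?thesis by (simp add: card_cartesian_product R_def)
qed

text \<open>The thinness is affine in \<open>k\<close>, and \<open>k\<close> can be chosen
  logarithmic in \<open>n\<close>. The constant \<open>B\<close> also covers the finitely many
  \<open>n\<close> below the asymptotic range.\<close>

lemma thinness_sublinear:
  assumes "0 < \<epsilon>"
  shows "\<exists>B\<ge>0. \<forall>n. \<exists>k. 3 * n \<le> 2 ^ k \<and> thinness k \<le> \<epsilon> * real n + B"
proof -
  define a where "a = C * (2 * \<delta> + C * (C * (2 * \<delta>)))"
  define c where "c = C * (2 * C + C * (C * (2 * C + 1))) + 1"
  have th: "thinness k = a * k + c" for k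
    by (simp add: thinness_def rad_def a_def c_def algebra_simps)
  have a: "0 \<le> a" and c: "0 \<le> c" using C_ge_1 hyp.delta_nonneg by (auto simp: a_def c_def)
  have "eventually (\<lambda>n. a * (log 2 (3 * real n + 1) + 1) \<le> \<epsilon> * real n) sequentially"
    using assms by real_asymp
  then obtain n0 where n0: "\<And>n. n \<ge> n0 \<Longrightarrow> a * (log 2 (3 * real n + 1) + 1) \<le> \<epsilon> * real n"
    by (auto simp: eventually_sequentially)
  define B where "B = a * (log 2 (3 * real n0 + 1) + 1) + c"
  show ?thesis
  proof (intro exI[of _ B] conjI allI)
    show "0 \<le> B" using a c by (simp add: B_def)
    fix n
    define k where "k = nat \<lceil>log 2 (3 * real n + 1)\<rceil>"
    have lg: "0 \<le> log 2 (3 * real n + 1)" by simp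
    have "3 * real n + 1 = 2 powr log 2 (3 * real n + 1)" by simp
    also have "\<dots> \<le> 2 powr real k"
      by (intro powr_mono) (auto simp: k_def)
    finally have "real (3 * n) \<le> real (2 ^ k)" by (simp add: powr_realpow)
    then have "3 * n \<le> 2 ^ k" by (simp only: of_nat_le_iff)
    moreover have "thinness k \<le> \<epsilon> * real n + B"
    proof -
      have "real k \<le> log 2 (3 * real n + 1) + 1" using lg unfolding k_def by linarith
      then have "a * k \<le> a * (log 2 (3 * real n + 1) + 1)" using a by (intro mult_left_mono)
      moreover have "a * (log 2 (3 * real n + 1) + 1) \<le> \<epsilon> * real n + a * (log 2 (3 * real n0 + 1) + 1)"
      proof (cases "n \<ge> n0")
        case True
        then show ?thesis using n0[of n] a by (simp add: add_increasing2)
      next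
        case False
        then have "log 2 (3 * real n + 1) \<le> log 2 (3 * real n0 + 1)" by simp
        then have "a * (log 2 (3 * real n + 1) + 1) \<le> a * (log 2 (3 * real n0 + 1) + 1)"
          using a by (intro mult_left_mono) auto
        then show ?thesis using assms by (simp add: add_increasing)
      qed
      ultimately show ?thesis by (simp add: th B_def)
    qed
    ultimately show "\<exists>k. 3 * n \<le> 2 ^ k \<and> thinness k \<le> \<epsilon> * real n + B" by blast
  qed
qed

end

section \<open>Growth rates\<close>

text \<open>Split off blocks of length \<open>m\<close>, each costing at most
  \<open>\<rho> ^ m\<close>. The remainder is below \<open>m\<close> and is absorbed by the sum
  \<open>C\<close> over all remainders.\<close>

lemma submultiplicative_upper:
  fixes u :: "nat \<Rightarrow> real"
  assumes pos: "\<And>n. 1 \<le> u n" and sub: "\<And>m n. u (m + n) \<le> u m * u n"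
    and m: "0 < m" "u m \<le> \<rho> ^ m" and \<rho>: "0 < \<rho>"
  shows "\<exists>C>0. \<forall>n. u n \<le> C * \<rho> ^ n"
proof -
  define C where "C = (\<Sum>r<m. u r / \<rho> ^ r)"
  have term_nonneg: "0 \<le> u r / \<rho> ^ r" for r using pos[of r] \<rho> by simp
  have "u n \<le> C * \<rho> ^ n" for n
  proof (induction n rule: less_induct)
    case (less n)
    show ?case
    proof (cases "n < m")
      case True
      then have "u n / \<rho> ^ n \<le> C"
        unfolding C_def using term_nonneg by (intro member_le_sum) auto
      then show ?thesis using \<rho> by (simp add: field_simps)
    next
      case False
      then have "u n \<le> u m * u (n - m)" using sub[of m "n - m"] by simp
      also have "\<dots> \<le> \<rho> ^ m * (C * \<rho> ^ (n - m))"
        using less False m \<rho> pos[of "n - m"] by (intro mult_mono) auto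
      also have "\<dots> = C * (\<rho> ^ m * \<rho> ^ (n - m))" by simp
      also have "\<dots> = C * \<rho> ^ n" using False by (simp flip: power_add)
      finally show ?thesis .
    qed
  qed
  moreover from this[of 0] have "0 < C" using pos[of 0] by simp
  ultimately show ?thesis by blast
qed

text \<open>Fekete's lemma in multiplicative form. The limit is the infimum of the roots, which
  gives the lower bound \<open>L ^ n\<close> without any constant.\<close>

lemma fekete:
  fixes u :: "nat \<Rightarrow> real"
  assumes pos: "\<And>n. 1 \<le> u n" and sub: "\<And>m n. u (m + n) \<le> u m * u n" and "u 0 = 1"
  obtains L where "1 \<le> L" "(\<lambda>n. root n (u n)) \<longlonglongrightarrow> L" "\<And>n. L ^ n \<le> u n"
    "\<And>\<rho>. L < \<rho> \<Longrightarrow> \<exists>C>0. \<forall>n. u n \<le> C * \<rho> ^ n"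
proof -
  \<comment> \<open>Index 0 is left out, because \<open>root 0\<close> is constantly 0.\<close>
  define L where "L = (INF n\<in>{1..}. root n (u n))"
  have r1: "1 \<le> root n (u n)" if "n \<ge> 1" for n using pos[of n] that by simp
  then have bdd: "bdd_below ((\<lambda>n. root n (u n)) ` {1..})" by (intro bdd_belowI2[of _ 1]) auto
  have Lle: "L \<le> root n (u n)" if "n \<ge> 1" for n
    unfolding L_def using bdd that by (intro cINF_lower) auto
  have L1: "1 \<le> L" unfolding L_def using r1 by (intro cINF_greatest) auto
  have pw: "L ^ n \<le> u n" for n
  proof (cases "n = 0")
    case False
    then have "L ^ n \<le> root n (u n) ^ n" using Lle[of n] L1 by (intro power_mono) auto
    also have "\<dots> = u n" using False pos[of n] by (intro real_root_pow_pos2) auto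
    finally show ?thesis .
  qed (simp add: assms)
  have upper: "\<exists>C>0. \<forall>n. u n \<le> C * \<rho> ^ n" if "L < \<rho>" for \<rho>
  proof -
    obtain m where m: "m \<ge> 1" "root m (u m) < \<rho>"
      using \<open>L < \<rho>\<close> bdd unfolding L_def by (subst (asm) cINF_less_iff) auto
    have "u m = root m (u m) ^ m" using m pos[of m] by (intro real_root_pow_pos2[symmetric]) auto
    also have "\<dots> \<le> \<rho> ^ m" using m r1[of m] by (intro power_mono) auto
    finally show ?thesis using submultiplicative_upper[OF pos sub, of m \<rho>] m that L1 by auto
  qed
  have "(\<lambda>n. root n (u n)) \<longlonglongrightarrow> L"
  proof (rule order_tendstoI)
    fix a assume "a < L"
    then show "eventually (\<lambda>n. a < root n (u n)) sequentially"
      using Lle by (intro eventually_sequentiallyI[of 1]) (meson less_le_trans)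
  next
    fix a assume a: "L < a"
    define \<rho> where "\<rho> = (L + a) / 2"
    have \<rho>: "L < \<rho>" "\<rho> < a" "0 < \<rho>" using a L1 by (auto simp: \<rho>_def)
    obtain C where C: "C > 0" "\<And>n. u n \<le> C * \<rho> ^ n" using upper[OF \<rho>(1)] by blast
    have "(\<lambda>n. root n C * \<rho>) \<longlonglongrightarrow> 1 * \<rho>"
      using C(1) by (intro tendsto_intros LIMSEQ_root_const)
    then have "eventually (\<lambda>n. root n C * \<rho> < a) sequentially"
      using \<rho> by (intro order_tendstoD(2)) auto
    then show "eventually (\<lambda>n. root n (u n) < a) sequentially"
      using eventually_ge_at_top[of 1]
    proof eventually_elim
      case (elim n)
      have "root n (u n) \<le> root n (C * \<rho> ^ n)" using C(2) elim by simp
      also have "\<dots> = root n C * \<rho>" using elim \<rho> by (simp add: real_root_mult real_root_power_cancel)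
      finally show ?case using elim by simp
    qed
  qed
  then show ?thesis using that L1 pw upper by blast
qed

lemma le_of_power_le:
  fixes a b :: real
  assumes "0 < b" and le: "\<And>n. a ^ n \<le> C * b ^ n"
  shows "a \<le> b"
proof (rule ccontr)
  assume "\<not> a \<le> b"
  then have "1 < a / b" using assms by (simp add: field_simps)
  then obtain n where "C < (a / b) ^ n" using real_arch_pow by blast
  then show False using le[of n] assms by (simp add: power_divide field_simps)
qed

section \<open>Sizes of balls and spheres\<close>

context word_norm
begin

definition ball_card :: "nat \<Rightarrow> nat" where
  "ball_card n = card {x \<in> carrier G. l x \<le> n}"

definition sphere_card :: "nat \<Rightarrow> nat" where
  "sphere_card n = card {x \<in> carrier G. l x = n}"

lemma finite_sphere: "finite {x \<in> carrier G. l x = n}"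
  by (rule finite_subset[OF _ finite_ball[of n]]) auto

lemma ball_card_0: "ball_card 0 = 1"
proof -
  have "{x \<in> carrier G. l x \<le> 0} = {\<one>}" using norm_zero by auto
  then show ?thesis by (simp add: ball_card_def)
qed

lemma sphere_card_0: "sphere_card 0 = 1"
proof -
  have "{x \<in> carrier G. l x = 0} = {\<one>}" using norm_zero by auto
  then show ?thesis by (simp add: sphere_card_def)
qed

lemma ball_card_pos: "1 \<le> ball_card n"
proof -
  have "card {\<one>} \<le> ball_card n"
    unfolding ball_card_def by (intro card_mono finite_ball) auto
  then show ?thesis by simp
qed

lemma sphere_card_pos: "infinite (carrier G) \<Longrightarrow> 1 \<le> sphere_card n"
  using unbounded_norm[of n] card_gt_0_iff[of "{x \<in> carrier G. l x = n}"] finite_sphere[of n]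
  by (auto simp: sphere_card_def Suc_le_eq)

lemma sphere_card_submult: "sphere_card (m + n) \<le> sphere_card m * sphere_card n"
proof -
  let ?S = "\<lambda>n. {x \<in> carrier G. l x = n}"
  have "?S (m + n) \<subseteq> (\<lambda>(x, y). x \<otimes> y) ` (?S m \<times> ?S n)"
  proof
    fix x assume "x \<in> ?S (m + n)"
    then obtain y z where "y \<in> carrier G" "z \<in> carrier G" "x = y \<otimes> z" "l y = m" "l z = n"
      using norm_split[of x m n] by auto
    then show "x \<in> (\<lambda>(x, y). x \<otimes> y) ` (?S m \<times> ?S n)" by force
  qed
  then have "card (?S (m + n)) \<le> card (?S m \<times> ?S n)"
    using finite_sphere by (intro surj_card_le finite_cartesian_product)
  then show ?thesis by (simp add: sphere_card_def card_cartesian_product)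
qed

lemma ball_card_submult: "ball_card (m + n) \<le> ball_card m * ball_card n"
proof -
  let ?B = "\<lambda>n. {x \<in> carrier G. l x \<le> n}"
  have "?B (m + n) \<subseteq> (\<lambda>(x, y). x \<otimes> y) ` (?B m \<times> ?B n)"
  proof
    fix x assume x: "x \<in> ?B (m + n)"
    define a where "a = min m (l x)"
    have "l x = a + (l x - a)" by (simp add: a_def)
    then obtain y z where "y \<in> carrier G" "z \<in> carrier G" "x = y \<otimes> z" "l y = a" "l z = l x - a"
      using norm_split[of x a "l x - a"] x by auto
    moreover from this have "l y \<le> m" "l z \<le> n" using x by (auto simp: a_def)
    ultimately show "x \<in> (\<lambda>(x, y). x \<otimes> y) ` (?B m \<times> ?B n)" by force
  qed
  then have "card (?B (m + n)) \<le> card (?B m \<times> ?B n)"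
    using finite_ball by (intro surj_card_le finite_cartesian_product)
  then show ?thesis by (simp add: ball_card_def card_cartesian_product)
qed

lemma ball_card_eq_sum: "ball_card n = (\<Sum>j\<le>n. sphere_card j)"
proof -
  have "{x \<in> carrier G. l x \<le> n} = (\<Union>j\<in>{..n}. {x \<in> carrier G. l x = j})" by auto
  then show ?thesis
    unfolding ball_card_def sphere_card_def
    by (simp only:) (rule card_UN_disjoint, auto simp: finite_sphere)
qed

definition rate :: real where
  "rate = lim (\<lambda>n. root n (real (ball_card n)))"

lemma rate_props:
  fixes \<rho> :: real
  shows rate_ge_1: "1 \<le> rate"
    and rate_power_le: "rate ^ n \<le> ball_card n"
    and ball_card_upper: "rate < \<rho> \<Longrightarrow> \<exists>C>0. \<forall>n. real (ball_card n) \<le> C * \<rho> ^ n"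
proof -
  obtain L where L: "1 \<le> L" "(\<lambda>n. root n (real (ball_card n))) \<longlonglongrightarrow> L"
    "\<And>n. L ^ n \<le> real (ball_card n)"
    "\<And>\<rho>. L < \<rho> \<Longrightarrow> \<exists>C>0. \<forall>n. real (ball_card n) \<le> C * \<rho> ^ n"
  proof (rule fekete[of "\<lambda>n. real (ball_card n)"])
    show "1 \<le> real (ball_card n)" for n using ball_card_pos[of n] by linarith
    show "real (ball_card (m + n)) \<le> real (ball_card m) * real (ball_card n)" for m n
      using ball_card_submult[of m n] by (simp flip: of_nat_mult)
  qed (auto simp: ball_card_0)
  have "rate = L" unfolding rate_def by (rule limI[OF L(2)])
  then show "1 \<le> rate" "rate ^ n \<le> ball_card n"
    "rate < \<rho> \<Longrightarrow> \<exists>C>0. \<forall>n. real (ball_card n) \<le> C * \<rho> ^ n"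
    using L(1) L(3)[of n] L(4)[of \<rho>] by simp_all
qed

text \<open>Sphere sizes are submultiplicative too and have a rate \<open>L\<close>. For each \<rho>
  above \<open>L\<close>, summing the sphere bounds as a geometric series bounds the balls by a
  multiple of \<open>\<rho> ^ n\<close>, so \<open>rate\<close> does not exceed
  \<open>L\<close>.\<close>

lemma sphere_card_lower:
  assumes "infinite (carrier G)"
  shows "rate ^ n \<le> sphere_card n"
proof -
  obtain L where L: "1 \<le> L"
    "\<And>n. L ^ n \<le> real (sphere_card n)"
    "\<And>\<rho>. L < \<rho> \<Longrightarrow> \<exists>C>0. \<forall>n. real (sphere_card n) \<le> C * \<rho> ^ n"
  proof (rule fekete[of "\<lambda>n. real (sphere_card n)"])
    show "1 \<le> real (sphere_card n)" for n using sphere_card_pos[OF assms, of n] by linarith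
    show "real (sphere_card (m + n)) \<le> real (sphere_card m) * real (sphere_card n)" for m n
      using sphere_card_submult[of m n] by (simp flip: of_nat_mult)
  qed (auto simp: sphere_card_0)
  have "rate \<le> \<rho>" if \<rho>: "L < \<rho>" for \<rho>
  proof -
    obtain C where C: "C > 0" "\<And>n. real (sphere_card n) \<le> C * \<rho> ^ n" using L(3)[OF \<rho>] by blast
    have "rate ^ n \<le> (C * \<rho> / (\<rho> - 1)) * \<rho> ^ n" for n
    proof -
      have "rate ^ n \<le> (\<Sum>j\<le>n. real (sphere_card j))"
        using rate_power_le[of n] by (simp add: ball_card_eq_sum)
      also have "\<dots> \<le> (\<Sum>j\<le>n. C * \<rho> ^ j)" by (intro sum_mono C)
      also have "\<dots> = C * ((\<rho> ^ Suc n - 1) / (\<rho> - 1))"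
        using \<rho> L(1) geometric_sum[of \<rho> "Suc n"] by (simp add: lessThan_Suc_atMost flip: sum_distrib_left)
      also have "\<dots> \<le> C * (\<rho> ^ Suc n / (\<rho> - 1))"
        using \<rho> L(1) C(1) by (intro mult_left_mono divide_right_mono) auto
      finally show ?thesis by simp
    qed
    then show ?thesis using \<rho> L(1) by (intro le_of_power_le[of \<rho> rate "C * \<rho> / (\<rho> - 1)"]) simp_all
  qed
  then have "rate \<le> L" by (rule dense_ge)
  then have "rate ^ n \<le> L ^ n" using rate_ge_1 by (intro power_mono) auto
  then show ?thesis using L(2)[of n] by linarith
qed

lemma rate_gt_1:
  assumes "\<And>m. 2 ^ m \<le> ball_card (m * P)"
  shows "1 < rate"
proof (rule ccontr)
  assume "\<not> 1 < rate"
  \<comment> \<open>Rate 1 would allow any base above 1. With this one the hypothesis gives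
    \<open>2 \<le> \<rho> ^ P\<close>, although already \<open>\<rho> ^ Suc P\<close> equals 2.
    Taking \<open>Suc P\<close> keeps the root meaningful for \<open>P = 0\<close>.\<close>
  define \<rho> :: real where "\<rho> = root (Suc P) 2"
  have \<rho>: "1 < \<rho>" "\<rho> ^ Suc P = 2" by (simp_all add: \<rho>_def real_root_pow_pos2 del: power_Suc)
  obtain C where C: "C > 0" "\<And>n. real (ball_card n) \<le> C * \<rho> ^ n"
    using ball_card_upper[of \<rho>] \<rho>(1) \<open>\<not> 1 < rate\<close> by auto
  have "2 ^ m \<le> C * (\<rho> ^ P) ^ m" for m
  proof -
    have "2 ^ m \<le> real (ball_card (m * P))"
      using assms[of m] by (metis of_nat_le_iff of_nat_numeral of_nat_power)
    also have "\<dots> \<le> C * (\<rho> ^ P) ^ m"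
      using C(2)[of "m * P"] by (simp add: power_mult mult.commute flip: power_mult)
    finally show ?thesis .
  qed
  then have "2 \<le> \<rho> ^ P" using \<rho>(1) by (intro le_of_power_le[of "\<rho> ^ P" 2 C]) simp_all
  moreover have "\<rho> ^ P < \<rho> ^ Suc P" using \<rho>(1) by (intro power_strict_increasing) auto
  ultimately show False using \<rho>(2) by linarith
qed

text \<open>Real radii, because the balls counted later have radii such as
  \<open>b - t + 2 * thinness k\<close>, which can be fractional or negative.\<close>

lemma card_real_ball_upper:
  fixes \<rho> :: real
  assumes "rate < \<rho>"
  shows "\<exists>C>0. \<forall>q. real (card {x \<in> carrier G. real (l x) \<le> q}) \<le> C * \<rho> powr q"
proof -
  obtain C where C: "C > 0" "\<And>n. real (ball_card n) \<le> C * \<rho> ^ n"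
    using ball_card_upper[OF assms] by blast
  have \<rho>: "1 < \<rho>" using assms rate_ge_1 by linarith
  have "real (card {x \<in> carrier G. real (l x) \<le> q}) \<le> C * \<rho> powr q" for q
  proof (cases "q < 0")
    case True
    then have "{x \<in> carrier G. real (l x) \<le> q} = {}" by auto
    then show ?thesis using C \<rho> by (simp only: card.empty) simp
  next
    case False
    then have "{x \<in> carrier G. real (l x) \<le> q} = {x \<in> carrier G. l x \<le> nat \<lfloor>q\<rfloor>}"
      by (auto simp: le_nat_floor le_nat_iff le_floor_iff)
    then have "real (card {x \<in> carrier G. real (l x) \<le> q}) \<le> C * \<rho> ^ nat \<lfloor>q\<rfloor>"
      using C(2)[of "nat \<lfloor>q\<rfloor>"] by (simp add: ball_card_def)
    also have "\<dots> = C * \<rho> powr real (nat \<lfloor>q\<rfloor>)" using \<rho> by (simp add: powr_realpow)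
    also have "\<dots> \<le> C * \<rho> powr q"
      using False \<rho> C by (intro mult_left_mono powr_mono) auto
    finally show ?thesis .
  qed
  then show ?thesis using C(1) by blast
qed

end

section \<open>Spheres in a direct product\<close>

text \<open>The situation of the theorem in terms of norms: lengths in the product are sums, and
  \<open>H\<close> outgrows \<open>K\<close>.\<close>

locale dominated_product = bilipschitz_hyperbolic_norm H l l0 \<delta> C + K: word_norm K lK
  for H (structure) and l l0 \<delta> C and K (structure) and lK +
  assumes infinite_H: "infinite (carrier H)"
    and rate_less: "K.rate < rate"
begin

lemma rate_greater_1: "1 < rate"
  using rate_less K.rate_ge_1 by linarith

definition sphere :: "nat \<Rightarrow> ('a \<times> 'c) set" where
  "sphere n = {(h, k). h \<in> carrier H \<and> k \<in> carrier K \<and> l h + lK k = n}"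

text \<open>The points whose distance from a point over \<open>h\<close> may be short. For
  \<open>h = \<one>\<close> and positive \<open>t\<close> the first alternative never holds, which
  leaves the points with a long \<open>K\<close>-component.\<close>

definition bad :: "real \<Rightarrow> nat \<Rightarrow> 'a \<Rightarrow> ('a \<times> 'c) set" where
  "bad t n h = {(h', k') \<in> sphere n. t \<le> gprod h h' \<or> t \<le> lK k'}"

lemma sphere_eq_Union:
  "sphere n = (\<Union>b\<in>{..n}. {h \<in> carrier H. l h = b} \<times> {k \<in> carrier K. lK k = n - b})"
  by (auto simp: sphere_def)

lemma finite_sphere_prod: "finite (sphere n)"
  unfolding sphere_eq_Union
  by (intro finite_UN_I finite_cartesian_product finite_sphere K.finite_sphere) auto

lemma card_sphere_ge: "rate ^ n \<le> card (sphere n)"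
proof -
  have "{h \<in> carrier H. l h = n} \<times> {\<one>\<^bsub>K\<^esub>} \<subseteq> sphere n" by (auto simp: sphere_def)
  then have "card ({h \<in> carrier H. l h = n} \<times> {\<one>\<^bsub>K\<^esub>}) \<le> card (sphere n)"
    by (intro card_mono finite_sphere_prod)
  then have "sphere_card n \<le> card (sphere n)"
    by (simp add: card_cartesian_product sphere_card_def)
  then show ?thesis using sphere_card_lower[OF infinite_H, of n] by linarith
qed

text \<open>Sort by the length \<open>b\<close> of \<open>h'\<close>. A large Gromov product
  (\<open>X b\<close>) shortens the count in \<open>H\<close> by \<open>t\<close>, up to three radii
  \<open>R\<close>. A long \<open>K\<close>-component (\<open>Y b\<close>) moves at least
  \<open>t\<close> units of length from exponent \<alpha> to exponent \<kappa>. One factor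
  \<open>n + 1\<close> comes from the sum over \<open>b\<close>, the other from
  \<open>card_large_gprod_le\<close>.\<close>

lemma card_bad_le:
  assumes h: "h \<in> carrier H" "l h \<le> n" and k: "3 * n \<le> 2 ^ k"
    and H: "\<And>q. real (card {x \<in> carrier H. real (l x) \<le> q}) \<le> A * rate powr (\<alpha> * q)"
    and K: "\<And>j. real (card {x \<in> carrier K. lK x = j}) \<le> A * rate powr (\<kappa> * j)"
    and A: "1 \<le> A" and \<kappa>: "0 \<le> \<kappa>" "\<kappa> \<le> \<alpha>" and t: "0 \<le> t"
  shows "card (bad t n h) \<le> 2 * A ^ 3 * (real n + 1)\<^sup>2 *
    (rate powr (\<alpha> * (n - t + 3 * thinness k)) + rate powr (\<alpha> * n - (\<alpha> - \<kappa>) * t))"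
proof -
  define R where "R = thinness k"
  define P where "P = rate powr (\<alpha> * (n - t + 3 * R)) + rate powr (\<alpha> * n - (\<alpha> - \<kappa>) * t)"
  have P0: "0 \<le> P" by (simp add: P_def)
  have r1: "1 < rate" by (rule rate_greater_1)
  let ?Kb = "\<lambda>b. {x \<in> carrier K. lK x = n - b}"
  define X where "X b = {h' \<in> carrier H. l h' = b \<and> t \<le> gprod h h'} \<times> ?Kb b" for b
  define Y where "Y b = (if t \<le> n - b then {h' \<in> carrier H. l h' = b} \<times> ?Kb b else {})" for b
  have fin: "finite (X b)" "finite (Y b)" for b
    unfolding X_def Y_def
    using finite_subset[OF _ finite_sphere[of b], of "{h' \<in> carrier H. l h' = b \<and> t \<le> gprod h h'}"]
      finite_sphere[of b] K.finite_sphere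
    by (auto intro!: finite_cartesian_product)
  have "bad t n h \<subseteq> (\<Union>b\<in>{..n}. X b \<union> Y b)"
  proof
    fix y assume y: "y \<in> bad t n h"
    then have "y \<in> X (l (fst y)) \<union> Y (l (fst y))" "l (fst y) \<le> n"
      by (auto simp: bad_def sphere_def X_def Y_def)
    then show "y \<in> (\<Union>b\<in>{..n}. X b \<union> Y b)" by blast
  qed
  then have "card (bad t n h) \<le> card (\<Union>b\<in>{..n}. X b \<union> Y b)"
    using fin by (intro card_mono) auto
  also have "\<dots> \<le> (\<Sum>b\<le>n. card (X b \<union> Y b))" by (rule card_UN_le) simp
  also have "\<dots> \<le> (\<Sum>b\<le>n. card (X b) + card (Y b))" by (intro sum_mono card_Un_le)
  finally have "real (card (bad t n h)) \<le> real (\<Sum>b\<le>n. card (X b) + card (Y b))"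
    by (rule of_nat_mono)
  also have "\<dots> = (\<Sum>b\<le>n. real (card (X b)) + real (card (Y b)))" by simp
  also have "\<dots> \<le> (\<Sum>b\<le>n. 2 * A ^ 3 * (real n + 1) * P)"
  proof (rule sum_mono)
    fix b assume "b \<in> {..n}"
    then have b: "b \<le> n" by simp
    then have n: "real n = real b + real (n - b)" by simp
    have "card {h' \<in> carrier H. l h' = b \<and> t \<le> gprod h h'} \<le>
      (n + 1) * (card {x \<in> carrier H. real (l x) \<le> R} * card {x \<in> carrier H. real (l x) \<le> b - t + 2 * R})"
      unfolding R_def by (rule card_large_gprod_le[OF h b k])
    then have "real (card {h' \<in> carrier H. l h' = b \<and> t \<le> gprod h h'}) \<le>
      real ((n + 1) * (card {x \<in> carrier H. real (l x) \<le> R} * card {x \<in> carrier H. real (l x) \<le> b - t + 2 * R}))"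
      by (rule of_nat_mono)
    also have "\<dots> = (real n + 1) * (real (card {x \<in> carrier H. real (l x) \<le> R}) *
        real (card {x \<in> carrier H. real (l x) \<le> b - t + 2 * R}))"
      by (simp add: distrib_right)
    also have "\<dots> \<le> (real n + 1) * ((A * rate powr (\<alpha> * R)) * (A * rate powr (\<alpha> * (b - t + 2 * R))))"
      using A by (intro mult_left_mono mult_mono H) auto
    finally have X1: "real (card {h' \<in> carrier H. l h' = b \<and> t \<le> gprod h h'}) \<le>
      (real n + 1) * ((A * rate powr (\<alpha> * R)) * (A * rate powr (\<alpha> * (b - t + 2 * R))))" .
    have "real (card (X b)) \<le> (real n + 1) * ((A * rate powr (\<alpha> * R)) * (A * rate powr (\<alpha> * (b - t + 2 * R))))
        * (A * rate powr (\<kappa> * real (n - b)))"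
      unfolding X_def card_cartesian_product of_nat_mult
      using A by (intro mult_mono X1 K) auto
    also have "\<dots> = A ^ 3 * (real n + 1) * rate powr (\<alpha> * R + \<alpha> * (b - t + 2 * R) + \<kappa> * real (n - b))"
      by (simp add: powr_add power3_eq_cube)
    also have "\<dots> \<le> A ^ 3 * (real n + 1) * P"
    proof (rule mult_left_mono)
      have "\<kappa> * real (n - b) \<le> \<alpha> * real (n - b)" using \<kappa> by (intro mult_right_mono) auto
      moreover have "\<alpha> * (n - t + 3 * R) = \<alpha> * R + \<alpha> * (b - t + 2 * R) + \<alpha> * real (n - b)"
        by (subst n) (simp add: algebra_simps)
      ultimately have "\<alpha> * R + \<alpha> * (b - t + 2 * R) + \<kappa> * real (n - b) \<le> \<alpha> * (n - t + 3 * R)"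
        by linarith
      then have "rate powr (\<alpha> * R + \<alpha> * (b - t + 2 * R) + \<kappa> * real (n - b)) \<le> rate powr (\<alpha> * (n - t + 3 * R))"
        by (rule powr_mono) (use r1 in simp)
      then show "rate powr (\<alpha> * R + \<alpha> * (b - t + 2 * R) + \<kappa> * real (n - b)) \<le> P"
        unfolding P_def by (smt (verit) powr_ge_zero)
    qed (use A in auto)
    finally have X2: "real (card (X b)) \<le> A ^ 3 * (real n + 1) * P" .
    have "real (card (Y b)) \<le> A ^ 3 * (real n + 1) * P"
    proof (cases "t \<le> n - b")
      case True
      have "card {h' \<in> carrier H. l h' = b} \<le> card {x \<in> carrier H. real (l x) \<le> real b}"
        using finite_ball[of b] by (intro card_mono) auto
      then have Y1: "real (card {h' \<in> carrier H. l h' = b}) \<le> A * rate powr (\<alpha> * b)"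
        using H[of "real b"] by linarith
      have "real (card (Y b)) = real (card {h' \<in> carrier H. l h' = b}) * real (card (?Kb b))"
        using True by (simp add: Y_def card_cartesian_product)
      also have "\<dots> \<le> (A * rate powr (\<alpha> * b)) * (A * rate powr (\<kappa> * real (n - b)))"
        by (intro mult_mono Y1 K) (use A in simp_all)
      also have "\<dots> = A ^ 2 * rate powr (\<alpha> * b + \<kappa> * real (n - b))"
        by (simp add: powr_add power2_eq_square)
      also have "\<dots> \<le> A ^ 3 * (real n + 1) * P"
      proof (rule mult_mono)
        have "A ^ 2 * 1 \<le> A ^ 3 * (real n + 1)"
          using A by (intro mult_mono power_increasing) auto
        then show "A ^ 2 \<le> A ^ 3 * (real n + 1)" by simp
        have "(\<alpha> - \<kappa>) * t \<le> (\<alpha> - \<kappa>) * real (n - b)"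
          using True \<kappa> by (intro mult_left_mono) auto
        moreover have "\<alpha> * n = \<alpha> * b + \<kappa> * real (n - b) + (\<alpha> - \<kappa>) * real (n - b)"
          by (subst n) (simp add: algebra_simps)
        ultimately have "\<alpha> * b + \<kappa> * real (n - b) \<le> \<alpha> * n - (\<alpha> - \<kappa>) * t"
          by linarith
        then have "rate powr (\<alpha> * b + \<kappa> * real (n - b)) \<le> rate powr (\<alpha> * n - (\<alpha> - \<kappa>) * t)"
          by (rule powr_mono) (use r1 in simp)
        then show "rate powr (\<alpha> * b + \<kappa> * real (n - b)) \<le> P"
          unfolding P_def by (smt (verit) powr_ge_zero)
      qed (use A in auto)
      finally show ?thesis .
    next
      case False
      then show ?thesis using A P0 by (simp add: Y_def)
    qed
    with X2 show "real (card (X b)) + real (card (Y b)) \<le> 2 * A ^ 3 * (real n + 1) * P" by simp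
  qed
  also have "\<dots> = 2 * A ^ 3 * (real n + 1)\<^sup>2 * P"
    by (simp add: power2_eq_square)
  finally show ?thesis by (simp add: P_def R_def)
qed

text \<open>Both exponents in \<open>card_bad_le\<close> are at most
  \<open>(1 - \<theta>) * n\<close> plus a constant, while the sphere has at least
  \<open>rate ^ n\<close> points. The bound \<open>q\<close> is uniform in \<open>h\<close>, so that
  it can be averaged.\<close>

lemma bad_negligible:
  fixes \<eta> :: real
  assumes \<eta>: "0 < \<eta>" "\<eta> < 1"
  shows "\<exists>q :: nat \<Rightarrow> real. q \<longlonglongrightarrow> 0 \<and> (\<forall>n. 0 \<le> q n) \<and> (\<forall>n. \<forall>h\<in>carrier H. l h \<le> n \<longrightarrow>
    real (card (bad (\<eta> * n) n h)) \<le> q n * card (sphere n))"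
proof -
  have r1: "1 < rate" by (rule rate_greater_1)
  define \<rho> where "\<rho> = (K.rate + rate) / 2"
  have \<rho>: "K.rate < \<rho>" "\<rho> < rate" "1 < \<rho>"
    using rate_less K.rate_ge_1 by (auto simp: \<rho>_def)
  define \<kappa> where "\<kappa> = log rate \<rho>"
  have \<kappa>: "0 < \<kappa>" "\<kappa> < 1" "rate powr \<kappa> = \<rho>"
    using \<rho> r1 by (auto simp: \<kappa>_def)
  \<comment> \<open>The saving per unit length. Replacing the exponent 1 by \<alpha> costs \<theta>,
    while long \<open>K\<close>-components gain at least \<open>(1 - \<kappa>) * \<eta>\<close>,
    which is \<open>4 * \<theta>\<close>, and large Gromov products gain at least
    \<open>\<eta> / 2\<close>, which is no less than \<open>2 * \<theta>\<close>.\<close>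
  define \<theta> where "\<theta> = (1 - \<kappa>) * \<eta> / 4"
  have \<theta>: "0 < \<theta>" "\<theta> \<le> \<eta> / 4" using \<kappa> \<eta> by (auto simp: \<theta>_def field_simps)
  define \<alpha> where "\<alpha> = 1 + \<theta>"
  have "rate powr 1 < rate powr \<alpha>" using r1 \<theta> by (intro powr_less_mono) (auto simp: \<alpha>_def)
  then obtain A1 where A1: "A1 > 0"
    "\<And>q. real (card {x \<in> carrier H. real (l x) \<le> q}) \<le> A1 * (rate powr \<alpha>) powr q"
    using card_real_ball_upper[of "rate powr \<alpha>"] r1 by auto
  obtain A2 where A2: "A2 > 0"
    "\<And>q. real (card {x \<in> carrier K. real (lK x) \<le> q}) \<le> A2 * \<rho> powr q"
    using K.card_real_ball_upper[OF \<rho>(1)] by auto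
  define A where "A = max 1 (max A1 A2)"
  have A: "1 \<le> A" "A1 \<le> A" "A2 \<le> A" by (auto simp: A_def)
  have H: "real (card {x \<in> carrier H. real (l x) \<le> q}) \<le> A * rate powr (\<alpha> * q)" for q
    using A1(2)[of q] mult_right_mono[OF A(2), of "rate powr (\<alpha> * q)"] by (simp add: powr_powr)
  have K: "real (card {x \<in> carrier K. lK x = j}) \<le> A * rate powr (\<kappa> * j)" for j
  proof -
    have "card {x \<in> carrier K. lK x = j} \<le> card {x \<in> carrier K. real (lK x) \<le> real j}"
      using K.finite_ball[of j] by (intro card_mono) auto
    then have "real (card {x \<in> carrier K. lK x = j}) \<le> A2 * (rate powr \<kappa>) powr j"
      using A2(2)[of "real j"] \<kappa>(3) by simp
    also have "\<dots> \<le> A * (rate powr \<kappa>) powr j" using A by (intro mult_right_mono) auto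
    finally show ?thesis by (simp add: powr_powr)
  qed
  \<comment> \<open>With slope \<open>\<eta> / 6\<close> the three thinness radii use up only half
    of the gain \<open>\<eta> * n\<close>.\<close>
  obtain B where B: "B \<ge> 0" "\<And>n. \<exists>k. 3 * n \<le> 2 ^ k \<and> thinness k \<le> \<eta> / 6 * real n + B"
    using thinness_sublinear[of "\<eta> / 6"] \<eta> by auto
  define D where "D = 2 * A ^ 3 * (rate powr (\<alpha> * (3 * B)) + 1)"
  define q where "q n = D * (real n + 1)\<^sup>2 * rate powr (- \<theta> * real n)" for n
  have "q \<longlonglongrightarrow> 0"
  proof -
    define c where "c = \<theta> * ln rate"
    have "0 < c" using r1 \<theta> by (simp add: c_def)
    then have "(\<lambda>n. (real n + 1)\<^sup>2 * exp (- c * real n)) \<longlonglongrightarrow> 0"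
      by real_asymp
    then have "(\<lambda>n. D * ((real n + 1)\<^sup>2 * exp (- c * real n))) \<longlonglongrightarrow> 0"
      by (rule tendsto_mult_right_zero)
    then show ?thesis
      using r1 by (simp add: q_def[abs_def] powr_def c_def mult_ac)
  qed
  moreover have "0 \<le> q n" for n using A by (simp add: q_def D_def)
  moreover have "real (card (bad (\<eta> * n) n h)) \<le> q n * card (sphere n)"
    if h: "h \<in> carrier H" "l h \<le> n" for n h
  proof -
    obtain k where k: "3 * n \<le> 2 ^ k" "thinness k \<le> \<eta> / 6 * real n + B" using B(2) by blast
    have e1: "\<alpha> * (n - \<eta> * n + 3 * thinness k) \<le> \<alpha> * (3 * B) + (1 - \<theta>) * n"
    proof -
      have "\<alpha> * (n - \<eta> * n + 3 * thinness k) \<le> \<alpha> * (n - \<eta> * n + 3 * (\<eta> / 6 * real n + B))"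
        using k \<theta> by (intro mult_left_mono) (auto simp: \<alpha>_def)
      also have "\<dots> = \<alpha> * (3 * B) + (\<alpha> * (1 - \<eta> / 2)) * n" by (simp add: field_simps)
      also have "\<alpha> * (1 - \<eta> / 2) \<le> 1 - \<theta>"
      proof -
        have "0 \<le> \<theta> * \<eta>" using \<theta> \<eta> by simp
        then show ?thesis using \<theta>(2) by (simp add: \<alpha>_def algebra_simps)
      qed
      finally show ?thesis by (simp add: mult_right_mono)
    qed
    have e2: "\<alpha> * n - (\<alpha> - \<kappa>) * (\<eta> * n) \<le> (1 - \<theta>) * n"
    proof -
      have "0 \<le> \<theta> * \<eta>" using \<theta> \<eta> by simp
      moreover have "4 * \<theta> = (1 - \<kappa>) * \<eta>" by (simp add: \<theta>_def)
      moreover have "\<alpha> - (\<alpha> - \<kappa>) * \<eta> = 1 + \<theta> - (1 - \<kappa>) * \<eta> - \<theta> * \<eta>"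
        by (simp add: \<alpha>_def algebra_simps)
      ultimately have "\<alpha> - (\<alpha> - \<kappa>) * \<eta> \<le> 1 - \<theta>"
        using \<theta> by linarith
      then have "(\<alpha> - (\<alpha> - \<kappa>) * \<eta>) * n \<le> (1 - \<theta>) * n" by (intro mult_right_mono) auto
      then show ?thesis by (simp add: algebra_simps)
    qed
    have "real (card (bad (\<eta> * n) n h)) \<le> 2 * A ^ 3 * (real n + 1)\<^sup>2 *
        (rate powr (\<alpha> * (n - \<eta> * n + 3 * thinness k)) + rate powr (\<alpha> * n - (\<alpha> - \<kappa>) * (\<eta> * n)))"
      using \<kappa> \<theta> \<eta> by (intro card_bad_le[OF h k(1) H K A(1)]) (auto simp: \<alpha>_def)
    also have "\<dots> \<le> 2 * A ^ 3 * (real n + 1)\<^sup>2 *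
        (rate powr (\<alpha> * (3 * B) + (1 - \<theta>) * n) + rate powr ((1 - \<theta>) * n))"
      using A r1 e1 e2 by (intro mult_left_mono add_mono powr_mono) auto
    also have "\<dots> = D * (real n + 1)\<^sup>2 * rate powr ((1 - \<theta>) * n)"
      unfolding D_def powr_add by algebra
    also have "(1 - \<theta>) * n = - \<theta> * n + n" by (simp add: algebra_simps)
    also have "rate powr (- \<theta> * n + n) = rate powr (- \<theta> * n) * rate ^ n"
      using r1 by (simp only: powr_add powr_realpow)
    also have "D * (real n + 1)\<^sup>2 * (rate powr (- \<theta> * n) * rate ^ n) = q n * rate ^ n"
      by (simp add: q_def)
    also have "\<dots> \<le> q n * card (sphere n)"
      using card_sphere_ge[of n] \<open>0 \<le> q n\<close> by (intro mult_left_mono)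
    finally show ?thesis .
  qed
  ultimately show ?thesis by blast
qed

section \<open>The mean distance on spheres of the product\<close>

definition pdist :: "'a \<times> 'c \<Rightarrow> 'a \<times> 'c \<Rightarrow> real" where
  "pdist x y = ndist (fst x) (fst y) + K.ndist (snd x) (snd y)"

definition mean :: "nat \<Rightarrow> real" where
  "mean n = 1 / (real (card (sphere n)))\<^sup>2 *
    (\<Sum>x\<in>sphere n. \<Sum>y\<in>sphere n. 1 / real n * pdist x y)"

lemma card_sphere_pos: "0 < card (sphere n)"
  using card_sphere_ge[of n] rate_greater_1 zero_less_power[of rate n] by linarith

lemma pdist_le:
  assumes "x \<in> sphere n" "y \<in> sphere n"
  shows "pdist x y \<le> 2 * n"
proof -
  obtain h k h' k' where [simp]: "x = (h, k)" "y = (h', k')" by (cases x, cases y)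
  have c: "h \<in> carrier H" "k \<in> carrier K" "h' \<in> carrier H" "k' \<in> carrier K"
    "l h + lK k = n" "l h' + lK k' = n"
    using assms by (auto simp: sphere_def)
  have "ndist h h' \<le> l h + l h'" "K.ndist k k' \<le> lK k + lK k'"
    using norm_mult[of "inv h" h'] K.norm_mult[of "inv\<^bsub>K\<^esub> k" k'] c
    by (auto simp: ndist_def K.ndist_def)
  then show ?thesis using c by (simp add: pdist_def)
qed

lemma mean_le: "mean n \<le> 2"
\<comment> \<open>For \<open>n = 0\<close> the factor \<open>1 / real n\<close> is 0, hence so is
  the mean.\<close>
proof (cases "n = 0")
  case False
  have "(\<Sum>x\<in>sphere n. \<Sum>y\<in>sphere n. 1 / real n * pdist x y) \<le> (\<Sum>x\<in>sphere n. \<Sum>y\<in>sphere n. 2)"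
    using pdist_le[of _ n] False by (intro sum_mono) (auto simp: field_simps)
  also have "\<dots> = 2 * (real (card (sphere n)))\<^sup>2" by (simp add: power2_eq_square)
  finally show ?thesis using card_sphere_pos[of n] by (simp add: mean_def field_simps)
qed (simp add: mean_def)

text \<open>The \<open>H\<close>-distance alone is \<open>2 * n\<close> minus \<open>lK k\<close>,
  \<open>lK k'\<close> and twice the Gromov product. Off the bad sets these losses total at most
  \<open>4 * \<eta> * n\<close>. If \<open>y\<close> is bad, its two losses are at most
  \<open>n + 2 * n\<close>; if \<open>x\<close> is bad, its loss is at most
  \<open>n\<close>.\<close>

lemma pdist_ge:
  fixes \<eta> :: real
  assumes x: "x \<in> sphere n" and y: "y \<in> sphere n" and \<eta>: "0 \<le> \<eta>"
  shows "pdist x y \<ge> (2 - 4 * \<eta>) * n - 3 * n * of_bool (y \<in> bad (\<eta> * n) n (fst x))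
    - n * of_bool (x \<in> bad (\<eta> * n) n \<one>)"
proof -
  obtain h k h' k' where [simp]: "x = (h, k)" "y = (h', k')" by (cases x, cases y)
  have c: "h \<in> carrier H" "k \<in> carrier K" "h' \<in> carrier H" "k' \<in> carrier K"
    "l h + lK k = n" "l h' + lK k' = n"
    using assms by (auto simp: sphere_def)
  have 1: "pdist x y \<ge> 2 * real n - lK k - lK k' - 2 * gprod h h'"
    using c by (simp add: pdist_def gprod_ndist field_simps)
  have kn: "real (lK k) \<le> n" "real (lK k') \<le> n" using c by linarith+
  have gn: "gprod h h' \<le> n" using gprod_le_left[OF c(1,3)] c by linarith
  have \<eta>n: "0 \<le> \<eta> * n" using \<eta> by simp
  have 2: "lK k' + 2 * gprod h h' \<le> 3 * (\<eta> * n) + 3 * n * of_bool (y \<in> bad (\<eta> * n) n h)"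
  proof (cases "y \<in> bad (\<eta> * n) n h")
    case True
    then show ?thesis using kn gn \<eta>n by simp
  next
    case False
    then have "gprod h h' < \<eta> * n" "lK k' < \<eta> * n"
      using y by (auto simp: bad_def not_le)
    then show ?thesis using False by simp
  qed
  have 3: "lK k \<le> \<eta> * n + n * of_bool (x \<in> bad (\<eta> * n) n \<one>)"
  proof (cases "x \<in> bad (\<eta> * n) n \<one>")
    case True
    then show ?thesis using kn \<eta>n by simp
  next
    case False
    then show ?thesis using x by (auto simp: bad_def not_le)
  qed
  show ?thesis using 1 2 3 by (simp add: algebra_simps)
qed

text \<open>Average \<open>pdist_ge\<close> over all pairs. Each bad set has proportion at most
  \<open>q\<close>, and the weights 3 and 1 add up to 4.\<close>

lemma mean_ge:
  fixes \<eta> q :: real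
  assumes n: "0 < n" and \<eta>: "0 \<le> \<eta>" and q: "0 \<le> q"
    and bad: "\<And>h. h \<in> carrier H \<Longrightarrow> l h \<le> n \<Longrightarrow> real (card (bad (\<eta> * n) n h)) \<le> q * card (sphere n)"
  shows "2 - 4 * \<eta> - 4 * q \<le> mean n"
proof -
  let ?S = "sphere n"
  define N where "N = real (card ?S)"
  have N: "0 < N" using card_sphere_pos by (simp add: N_def)
  have sb: "(\<Sum>y\<in>?S. of_bool (y \<in> bad (\<eta> * n) n h) :: real) \<le> q * N"
    if "h \<in> carrier H" "l h \<le> n" for h
  proof -
    have "?S \<inter> {y. y \<in> bad (\<eta> * n) n h} = bad (\<eta> * n) n h" by (auto simp: bad_def)
    then show ?thesis
      using bad[OF that] finite_sphere_prod by (simp add: N_def)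
  qed
  have "N * ((2 - 4 * \<eta>) * N - 3 * (q * N)) - N * (q * N) \<le>
      (\<Sum>x\<in>?S. (2 - 4 * \<eta>) * N - 3 * (q * N)) - (\<Sum>x\<in>?S. N * of_bool (x \<in> bad (\<eta> * n) n \<one>))"
    using sb[OF one_closed] N by (simp add: N_def flip: sum_distrib_left)
  also have "\<dots> = (\<Sum>x\<in>?S. (2 - 4 * \<eta>) * N - 3 * (q * N) - N * of_bool (x \<in> bad (\<eta> * n) n \<one>))"
    by (simp add: sum_subtractf)
  also have "\<dots> \<le> (\<Sum>x\<in>?S. \<Sum>y\<in>?S. 1 / real n * pdist x y)"
  proof (rule sum_mono)
    fix x assume x: "x \<in> ?S"
    then have fx: "fst x \<in> carrier H" "l (fst x) \<le> n" by (auto simp: sphere_def)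
    have "(2 - 4 * \<eta>) * N - 3 * (q * N) - N * of_bool (x \<in> bad (\<eta> * n) n \<one>) \<le>
      (2 - 4 * \<eta>) * N - 3 * (\<Sum>y\<in>?S. of_bool (y \<in> bad (\<eta> * n) n (fst x)))
        - N * of_bool (x \<in> bad (\<eta> * n) n \<one>)"
      using sb[OF fx] by simp
    also have "\<dots> = (\<Sum>y\<in>?S. (2 - 4 * \<eta>) - 3 * of_bool (y \<in> bad (\<eta> * n) n (fst x))
        - of_bool (x \<in> bad (\<eta> * n) n \<one>))"
      by (simp add: sum_subtractf N_def sum_distrib_left)
    also have "\<dots> \<le> (\<Sum>y\<in>?S. 1 / real n * pdist x y)"
    proof (rule sum_mono)
      fix y assume y: "y \<in> ?S"
      have "n * ((2 - 4 * \<eta>) - 3 * of_bool (y \<in> bad (\<eta> * n) n (fst x))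
          - of_bool (x \<in> bad (\<eta> * n) n \<one>)) \<le> pdist x y"
        using pdist_ge[OF x y \<eta>] by (simp add: algebra_simps)
      then show "(2 - 4 * \<eta>) - 3 * of_bool (y \<in> bad (\<eta> * n) n (fst x))
          - of_bool (x \<in> bad (\<eta> * n) n \<one>) \<le> 1 / real n * pdist x y"
        using n by (simp add: pos_le_divide_eq mult.commute)
    qed
    finally show "(2 - 4 * \<eta>) * N - 3 * (q * N) - N * of_bool (x \<in> bad (\<eta> * n) n \<one>)
        \<le> (\<Sum>y\<in>?S. 1 / real n * pdist x y)" .
  qed
  finally have "(2 - 4 * \<eta> - 4 * q) * N\<^sup>2 \<le> (\<Sum>x\<in>?S. \<Sum>y\<in>?S. 1 / real n * pdist x y)"
    by (simp add: algebra_simps power2_eq_square)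
  then show ?thesis using N by (simp add: mean_def field_simps flip: N_def)
qed

lemma mean_tendsto_2: "mean \<longlonglongrightarrow> 2"
proof (rule order_tendstoI)
  fix a :: real assume "a < 2"
  \<comment> \<open>Once \<open>q n\<close> is below \<eta>, the total loss is less than
    \<open>8 * \<eta>\<close>, at most \<open>2 - a\<close>. The cap keeps \<eta> below 1.\<close>
  define \<eta> where "\<eta> = min (1 / 2) ((2 - a) / 8)"
  have \<eta>: "0 < \<eta>" "\<eta> < 1" "8 * \<eta> \<le> 2 - a" using \<open>a < 2\<close> by (auto simp: \<eta>_def min_def)
  obtain q :: "nat \<Rightarrow> real" where q: "q \<longlonglongrightarrow> 0" "\<And>n. 0 \<le> q n" "\<And>n h. h \<in> carrier H \<Longrightarrow> l h \<le> n \<Longrightarrow>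
    real (card (bad (\<eta> * n) n h)) \<le> q n * card (sphere n)"
    using bad_negligible[OF \<eta>(1,2)] by blast
  have "eventually (\<lambda>n. q n < \<eta>) sequentially" using q(1) \<eta>(1) by (rule order_tendstoD)
  then show "eventually (\<lambda>n. a < mean n) sequentially"
    using eventually_gt_at_top[of 0]
  proof eventually_elim
    case (elim n)
    then have "2 - 4 * \<eta> - 4 * q n \<le> mean n"
      using mean_ge[of n \<eta> "q n"] q \<eta> by simp
    then show ?case using elim \<eta> by linarith
  qed
next
  fix a :: real assume "2 < a"
  then show "eventually (\<lambda>n. mean n < a) sequentially"
    using mean_le by (intro always_eventually allI) (meson le_less_trans)
qed

end

section \<open>From abstract norms back to word metrics\<close>

context word_generated
begin

lemma growth_function_eq: "growth_function G S n = norm.ball_card n"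
  unfolding growth_function_def norm.ball_card_def
  by (rule arg_cong[of _ _ card]) (auto simp: word_dist_one)

lemma growth_rate_eq: "growth_rate G S = norm.rate"
  by (simp add: growth_rate_def norm.rate_def growth_function_eq)

text \<open>Specialise the base point to \<open>\<one>\<close>, where \<open>gromov_product\<close>
  becomes \<open>gprod\<close>.\<close>

lemma hyperbolic_norm_word_length:
  assumes "gromov_hyperbolic_on (carrier G) (\<lambda>x y. real (word_dist G S x y))"
  shows "\<exists>\<delta>. hyperbolic_norm G (word_length G S) \<delta>"
proof -
  obtain \<delta> where \<delta>: "\<delta> \<ge> 0" "\<And>w x y z. \<lbrakk>w \<in> carrier G; x \<in> carrier G; y \<in> carrier G; z \<in> carrier G\<rbrakk> \<Longrightarrow>
    gromov_product (\<lambda>x y. real (word_dist G S x y)) w x z \<ge>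
      min (gromov_product (\<lambda>x y. real (word_dist G S x y)) w x y)
        (gromov_product (\<lambda>x y. real (word_dist G S x y)) w y z) - \<delta>"
    using assms unfolding gromov_hyperbolic_on_def by blast
  have "gromov_product (\<lambda>x y. real (word_dist G S x y)) \<one> x y = norm.gprod x y"
    if "x \<in> carrier G" "y \<in> carrier G" for x y
    using that by (simp add: gromov_product_def norm.gprod_def word_dist_def word_length_inv)
  then have "hyperbolic_norm G (word_length G S) \<delta>"
    using \<delta>(1) \<delta>(2)[of \<one>] by unfold_locales auto
  then show ?thesis by blast
qed

lemma word_length_bilipschitz:
  assumes "word_generated G T"
  shows "\<exists>C\<ge>1. \<forall>x\<in>carrier G. word_length G T x \<le> C * word_length G S x"
proof -
  interpret T: word_generated G T by fact
  define C where "C = max 1 (Max (word_length G T ` letters))"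
  have "word_length G T x \<le> C * word_length G S x" if "x \<in> carrier G" for x
  proof (rule lipschitz_word_length[OF _ _ _ that])
    show "word_length G T a \<le> C" if "a \<in> letters" for a
      using that finite_letters unfolding C_def by (intro max.coboundedI2 Max_ge) auto
  qed (auto simp: T.word_length_one T.word_length_mult)
  then show ?thesis by (intro exI[of _ C]) (auto simp: C_def)
qed

end

context split_product
begin

lemma word_dist_split_product:
  assumes "h \<in> carrier H" "h' \<in> carrier H" "k \<in> carrier K" "k' \<in> carrier K"
  shows "word_dist (H \<times>\<times> K) S (h, k) (h', k') =
    word_dist H (fst ` S) h h' + word_dist K (snd ` S) k k'"
  using assms inv_DirProd[OF H.group_axioms K.group_axioms, of h k]
  by (simp add: word_dist_def word_length_split_product)

end

theorem proposition6:
  fixes H :: "('a, 'm) monoid_scheme"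
    and K :: "('b, 'n) monoid_scheme"
    and S :: "('a \<times> 'b) set"
  assumes "hyperbolic_group H" and "non_elementary H"
    and "finitely_generated_group K"
    and "finite_generating_set (H \<times>\<times> K) S"
    and "split_set H K S"
    and "growth_dominates H (fst ` S) K (snd ` S)"
  shows "statistically_hyperbolic (H \<times>\<times> K) S"
proof -
  have grp: "group H" "group K"
    using assms(1,3) by (auto simp: hyperbolic_group_def finitely_generated_group_def)
  interpret H: group H by fact
  interpret K: group K by fact
  obtain T where T: "finite_generating_set H T"
    and hyp: "gromov_hyperbolic_on (carrier H) (\<lambda>x y. real (word_dist H T x y))"
    using assms(1) by (auto simp: hyperbolic_group_def)
  interpret T: word_generated H T by (rule word_generatedI[OF grp(1) T])
  interpret P: word_generated "H \<times>\<times> K" S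
    by (rule word_generatedI[OF DirProd_group[OF grp] assms(4)])
  interpret P: split_product H K S
    by unfold_locales (rule assms(5))
  let ?nH = "word_length H (fst ` S)" and ?nK = "word_length K (snd ` S)" and ?nT = "word_length H T"
  obtain \<delta> where "hyperbolic_norm H ?nT \<delta>"
    using T.hyperbolic_norm_word_length[OF hyp] by blast
  interpret hyperbolic_norm H ?nT \<delta> by fact
  obtain C1 where C1: "C1 \<ge> 1" "\<And>x. x \<in> carrier H \<Longrightarrow> ?nH x \<le> C1 * ?nT x"
    using T.word_length_bilipschitz[OF P.H.word_generated_axioms] by blast
  obtain C2 where C2: "C2 \<ge> 1" "\<And>x. x \<in> carrier H \<Longrightarrow> ?nT x \<le> C2 * ?nH x"
    using P.H.word_length_bilipschitz[OF T.word_generated_axioms] by blast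
  have inf: "infinite (carrier H)" using assms(2) by (simp add: non_elementary_def)
  obtain L where L: "\<And>m. 2 ^ m \<le> card {v \<in> carrier H. ?nT v \<le> m * L}"
    using non_elementary_imp_exponential_growth[OF assms(2)] by blast
  \<comment> \<open>Exponential growth was obtained for \<open>T\<close>. It passes to the projected
    generators because a \<open>T\<close>-ball lies in a ball whose radius is \<open>C1\<close>
    times as large.\<close>
  have "2 ^ m \<le> P.H.norm.ball_card (m * (C1 * L))" for m
  proof -
    have "{v \<in> carrier H. ?nT v \<le> m * L} \<subseteq> {v \<in> carrier H. ?nH v \<le> m * (C1 * L)}"
    proof
      fix v assume "v \<in> {v \<in> carrier H. ?nT v \<le> m * L}"
      then have v: "v \<in> carrier H" "?nT v \<le> m * L" by auto
      have "?nH v \<le> C1 * ?nT v" by (rule C1(2)[OF v(1)])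
      also have "\<dots> \<le> C1 * (m * L)" using v by simp
      finally show "v \<in> {v \<in> carrier H. ?nH v \<le> m * (C1 * L)}" using v by (simp add: mult_ac)
    qed
    then have "card {v \<in> carrier H. ?nT v \<le> m * L} \<le> P.H.norm.ball_card (m * (C1 * L))"
      unfolding P.H.norm.ball_card_def by (intro card_mono P.H.norm.finite_ball)
    then show ?thesis using L[of m] by linarith
  qed
  then have "1 < P.H.norm.rate" by (rule P.H.norm.rate_gt_1)
  \<comment> \<open>Subexponential growth of \<open>K\<close> means rate 1, so both cases of
    domination give a strict inequality of rates.\<close>
  then have rates: "P.K.norm.rate < P.H.norm.rate"
    using assms(6) by (auto simp: growth_dominates_def subexponential_growth_def
        P.H.growth_rate_eq P.K.growth_rate_eq)
  define C where "C = real (max C1 C2)"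
  interpret D: dominated_product H ?nH ?nT \<delta> C K ?nK
  proof unfold_locales
    show "1 \<le> C" using C1 by (simp add: C_def)
    fix x assume x: "x \<in> carrier H"
    have "real (?nH x) \<le> real C1 * real (?nT x)" "real (?nT x) \<le> real C2 * real (?nH x)"
      using C1(2)[OF x] C2(2)[OF x] by (simp_all flip: of_nat_mult)
    moreover have "real C1 * real (?nT x) \<le> C * real (?nT x)" "real C2 * real (?nH x) \<le> C * real (?nH x)"
      by (auto simp: C_def intro!: mult_right_mono)
    ultimately show "real (?nH x) \<le> C * real (?nT x)" "real (?nT x) \<le> C * real (?nH x)"
      by linarith+
  qed (fact inf rates)+
  have sphere: "word_sphere (H \<times>\<times> K) S n = D.sphere n" for n
    by (auto simp: word_sphere_def D.sphere_def P.word_dist_split_product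
        P.H.word_dist_one P.K.word_dist_one)
  have "mean_sphere_dist (H \<times>\<times> K) S = D.mean"
  proof
    fix n
    have "P.H.norm.ndist = word_dist H (fst ` S)" "P.K.norm.ndist = word_dist K (snd ` S)"
      by (intro ext; simp add: P.H.norm.ndist_def P.K.norm.ndist_def word_dist_def)+
    then have "real (word_dist (H \<times>\<times> K) S x y) = D.pdist x y"
      if "x \<in> D.sphere n" "y \<in> D.sphere n" for x y
      using that by (auto simp: D.sphere_def D.pdist_def P.word_dist_split_product)
    then show "mean_sphere_dist (H \<times>\<times> K) S n = D.mean n"
      by (simp add: mean_sphere_dist_def D.mean_def sphere)
  qed
  then show ?thesis
    using D.mean_tendsto_2 unfolding statistically_hyperbolic_def sprawl_def
    by (auto simp: convergent_def intro: limI)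
qed

end
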